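(* If $P_X^*$ has finite second moment, then the problem $$\mathcal L(P_W,P_X^*,c_I):\quad \inf_{S:\,S\#P_W=P_X^*}\int_{\mathsf W}\|u-S(u)\|^2\,P_W(du)$$ has a unique optimal solution $\phi$, which satisfies $\phi\#P_W=P_X^*$.
   Context: $\mathsf W,\mathsf X\subset\mathbb R^d$ with Borel $\sigma$-algebras; $\mathsf W$ is open, bounded and convex. $P_W$ is the uniform distribution on $\mathsf W$. $P_X^*\in\mathcal P(\mathsf X)$ is the capacity-achieving input distribution of a channel $P_{Y|X}$ (a transition kernel from $\mathsf X$ to a Euclidean space $\mathsf Y$), i.e. a maximizer of the mutual information $I(P_X,P_{Y|X})$ over probability measures $P_X$ on $\mathsf X$ with $\mathbb E_{P_X}[\eta(X)]\le L$ for a given cost $\eta:\mathsf X\to\mathbb R_+$ and $L$; the capacity $I(P_X^*,P_{Y|X})$ is assumed finite. $\|\cdot\|$ is the Euclidean norm and $c_I(u,v)=\|u-v\|^2$. $S\#P=Q$ means that $S$ pushes $P$ forward to $Q$; the infimum is over Borel maps $S:\mathsf W\to\mathsf X$. As usual in optimal transport, maps agreeing $P_W$-almost everywhere are identified when speaking of uniqueness.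
   Formalization: The set X is assumed to be a Borel subset of R^d; for a non-measurable X (outer Lebesgue measure 1, inner measure 0 in (0,1), with the trace of Lebesgue measure) no Borel map from W to X pushes P_W to P_X^*, so the claim fails. *)

theory Defs
  imports "HOL-Probability.Probability"
begin

section \<open>Mutual information and capacity-achieving inputs\<close>

text \<open>
  The library's \<^const>\<open>KL_divergence\<close> is a Bochner integral, which is \<open>0\<close> by convention when the
  integrand is not integrable. The negative part of \<open>ln (dQ/dP)\<close> is always \<open>Q\<close>-integrable for
  probability measures, so the divergence is \<open>\<infinity>\<close> exactly when \<open>Q\<close> is not absolutely continuous
  with respect to \<open>P\<close> or \<open>ln (dQ/dP)\<close> is not \<open>Q\<close>-integrable. As in the library, \<open>relative_entropy P Q\<close>
  is \<open>D(Q || P)\<close>. It is measured in nats.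
\<close>

definition relative_entropy :: "'a measure \<Rightarrow> 'a measure \<Rightarrow> ereal" where
  "relative_entropy P Q =
    (if absolutely_continuous P Q \<and> integrable Q (entropy_density (exp 1) P Q)
     then ereal (KL_divergence (exp 1) P Q) else \<infinity>)"

text \<open>The law of \<open>(X, Y)\<close> when \<open>X\<close> has law \<open>P\<close> and \<open>Y\<close> has conditional law \<open>K x\<close> given \<open>X = x\<close>.\<close>

definition channel_joint ::
    "'a measure \<Rightarrow> ('a \<Rightarrow> 'b::euclidean_space measure) \<Rightarrow> ('a \<times> 'b) measure" where
  "channel_joint P K = P \<bind> (\<lambda>x. distr (K x) (P \<Otimes>\<^sub>M borel) (Pair x))"

definition channel_information ::
    "'a measure \<Rightarrow> ('a \<Rightarrow> 'b::euclidean_space measure) \<Rightarrow> ereal" where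
  "channel_information P K = relative_entropy (P \<Otimes>\<^sub>M (P \<bind> K)) (channel_joint P K)"

text \<open>For the nonnegative costs considered here, integrability means that the expected cost is finite.\<close>

definition admissible_inputs :: "'a measure \<Rightarrow> ('a \<Rightarrow> real) \<Rightarrow> real \<Rightarrow> 'a measure set" where
  "admissible_inputs MX \<eta> L =
    {P \<in> space (prob_algebra MX). integrable P \<eta> \<and> (\<integral>x. \<eta> x \<partial>P) \<le> L}"

definition capacity_achieving ::
    "'a measure \<Rightarrow> ('a \<Rightarrow> 'b::euclidean_space measure) \<Rightarrow> ('a \<Rightarrow> real) \<Rightarrow> real \<Rightarrow> 'a measure \<Rightarrow> bool"
where
  "capacity_achieving MX K \<eta> L P \<longleftrightarrow>
    is_arg_max (\<lambda>P. channel_information P K) (\<lambda>P. P \<in> admissible_inputs MX \<eta> L) P"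

section \<open>The Monge problem\<close>

definition uniform_on :: "'a::euclidean_space set \<Rightarrow> 'a measure" where
  "uniform_on W = uniform_measure (restrict_space lborel W) W"

definition transport_maps :: "'a measure \<Rightarrow> 'b measure \<Rightarrow> ('a \<Rightarrow> 'b) set" where
  "transport_maps P Q = {S \<in> P \<rightarrow>\<^sub>M Q. distr P Q S = Q}"

definition transport_cost ::
    "('a \<Rightarrow> 'b \<Rightarrow> real) \<Rightarrow> 'a measure \<Rightarrow> ('a \<Rightarrow> 'b) \<Rightarrow> ennreal" where
  "transport_cost c P S = (\<integral>\<^sup>+u. ennreal (c u (S u)) \<partial>P)"

definition monge_optimal ::
    "'a measure \<Rightarrow> 'b measure \<Rightarrow> ('a \<Rightarrow> 'b \<Rightarrow> real) \<Rightarrow> ('a \<Rightarrow> 'b) \<Rightarrow> bool" where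
  "monge_optimal P Q c S \<longleftrightarrow>
    S \<in> transport_maps P Q \<and> transport_cost c P S = (INF T \<in> transport_maps P Q. transport_cost c P T)"

definition cost_I :: "'a::real_normed_vector \<Rightarrow> 'a \<Rightarrow> real" where
  "cost_I u v = (norm (u - v))\<^sup>2"

end

theory Submission
  imports Defs "HOL-Complex_Analysis.Great_Picard"
begin

text \<open>
  Expanding the square, a map \<open>S\<close> is optimal iff it maximizes \<open>\<integral> u \<bullet> S u\<close>. The dual problem is to
  minimize \<open>\<integral> \<psi>\<^sup>* dM + \<integral> \<psi> dN\<close>, where \<open>\<psi>\<^sup>*\<close> is the Legendre transform. Because \<open>M\<close> lives in a ball of
  radius \<open>R\<close>, one may restrict to \<open>R\<close>-Lipschitz \<open>\<psi>\<close> with \<open>\<psi> 0 = 0\<close>, so a minimizer exists by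
  compactness and Fatou's lemma. For almost every \<open>x\<close> the supremum defining \<open>\<psi>\<^sup>* x\<close> is attained at
  exactly one point \<open>T x\<close>, and the first variation of the dual functional says that \<open>T\<close> pushes \<open>M\<close>
  forward to \<open>N\<close> (Gangbo's proof of Brenier's theorem). Integrating \<open>u \<bullet> S u \<le> \<psi>\<^sup>* u + \<psi> (S u)\<close>,
  whose equality case is \<open>S u = T u\<close>, gives optimality and uniqueness at once.
\<close>

section \<open>Measures, Lipschitz functions and null sets\<close>

text \<open>Complements reverse the inequality on open sets, and outer regularity extends the
  reversed one to all Borel sets. Total mass one then forces equality, by comparing a set and its
  complement. Thus a one-sided estimate is enough to identify a pushforward.\<close>

lemma prob_measures_eqI_closed:
  fixes P Q :: "'a::{second_countable_topology, complete_space} measure"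
  assumes P: "prob_space P" "sets P = sets borel" and Q: "prob_space Q" "sets Q = sets borel"
    and le: "\<And>C. closed C \<Longrightarrow> measure P C \<le> measure Q C"
  shows "P = Q"
proof -
  interpret P: prob_space P by fact
  interpret Q: prob_space Q by fact
  have sp: "space P = UNIV" "space Q = UNIV"
    using P(2) Q(2) by (metis sets_eq_imp_space_eq space_borel)+
  have op: "emeasure Q U \<le> emeasure P U" if "open U" for U
  proof -
    have "measure P (- U) \<le> measure Q (- U)" using that by (intro le) auto
    moreover have "measure P (- U) = 1 - measure P U" "measure Q (- U) = 1 - measure Q U"
      using P.prob_compl[of U] Q.prob_compl[of U] that P(2) Q(2) sp by (auto simp: Compl_eq_Diff_UNIV)
    ultimately show ?thesis by (simp add: P.emeasure_eq_measure Q.emeasure_eq_measure)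
  qed
  have bo: "emeasure Q B \<le> emeasure P B" if "B \<in> sets borel" for B
    using that P(2) Q(2)
    by (subst (1 2) outer_regular) (auto intro!: INF_mono op)
  show ?thesis
  proof (rule measure_eqI)
    fix B assume B: "B \<in> sets P"
    then have "- B \<in> sets borel" using P(2) by auto
    from bo[OF this] have "measure Q (- B) \<le> measure P (- B)"
      by (simp add: P.emeasure_eq_measure Q.emeasure_eq_measure)
    moreover have "measure P (- B) = 1 - measure P B" "measure Q (- B) = 1 - measure Q B"
      using P.prob_compl[of B] Q.prob_compl[of B] B P(2) Q(2) sp by (auto simp: Compl_eq_Diff_UNIV)
    moreover have "measure Q B \<le> measure P B"
      using bo[of B] B P(2) by (simp add: P.emeasure_eq_measure Q.emeasure_eq_measure)
    ultimately show "emeasure P B = emeasure Q B"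
      by (simp add: P.emeasure_eq_measure Q.emeasure_eq_measure)
  qed (simp add: P Q)
qed

text \<open>A diagonal subsequence converges on a countable dense set, and the common Lipschitz
  constant carries convergence to every point. Pointwise convergence is what Fatou's lemma will ask
  for.\<close>

lemma lipschitz_convergent_subsequence:
  fixes f :: "nat \<Rightarrow> 'a::euclidean_space \<Rightarrow> real"
  assumes lip: "\<And>n. R-lipschitz_on UNIV (f n)" and zero: "\<And>n. f n 0 = 0"
  obtains k g where "strict_mono (k :: nat \<Rightarrow> nat)" "R-lipschitz_on UNIV g"
    "\<And>y. (\<lambda>n. f (k n) y) \<longlonglongrightarrow> g y"
proof -
  have R0: "R \<ge> 0" using lip lipschitz_on_nonneg by blast
  have lipD: "\<bar>f n x - f n y\<bar> \<le> R * norm (x - y)" for n x y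
    using lipschitz_onD[OF lip[of n], of x y] by (simp add: dist_norm)
  obtain D :: "'a set" where D: "countable D" "\<And>X. open X \<Longrightarrow> X \<noteq> {} \<Longrightarrow> \<exists>d \<in> D. d \<in> X"
    using countable_dense_setE by blast
  \<comment> \<open>The weight \<open>1 + norm y\<close> turns the bound \<open>R * norm y\<close>
    into one that is uniform in \<open>y\<close>, as the diagonal extraction requires.\<close>
  have "norm (f n y / (1 + norm y)) \<le> R" for n y
  proof -
    have "\<bar>f n y\<bar> \<le> R * norm y" using lipD[of n y 0] zero by simp
    also have "\<dots> \<le> R * (1 + norm y)" using R0 by (simp add: mult_left_mono)
    finally show ?thesis by (simp add: divide_simps add_pos_nonneg)
  qed
  then obtain k where k: "strict_mono (k::nat\<Rightarrow>nat)"
    "\<And>y. y \<in> D \<Longrightarrow> \<exists>l. (\<lambda>n. f (k n) y / (1 + norm y)) \<longlonglongrightarrow> l"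
    using function_convergent_subsequence[of D "\<lambda>n y. f n y / (1 + norm y)" R] D(1) by metis
  have conv_D: "convergent (\<lambda>n. f (k n) y)" if y: "y \<in> D" for y
  proof -
    obtain l where "(\<lambda>n. f (k n) y / (1 + norm y)) \<longlonglongrightarrow> l" using k(2)[OF y] by blast
    then have "(\<lambda>n. f (k n) y / (1 + norm y) * (1 + norm y)) \<longlonglongrightarrow> l * (1 + norm y)"
      by (intro tendsto_intros)
    moreover have "1 + norm y \<noteq> 0" using norm_ge_zero[of y] by linarith
    ultimately show ?thesis by (auto simp: convergent_def)
  qed
  have conv: "convergent (\<lambda>n. f (k n) y)" for y
  proof -
    have "Cauchy (\<lambda>n. f (k n) y)"
    proof (rule CauchyI')
      fix e :: real assume e: "e > 0"
      \<comment> \<open>The summand \<open>1\<close> keeps the denominator positive when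
        \<open>R = 0\<close>. Moving from \<open>y\<close> to a dense point \<open>z\<close> costs
        \<open>e / 4\<close> at each of two indices, and the Cauchy estimate at \<open>z\<close>
        costs a third \<open>e / 4\<close>.\<close>
      define d where "d = e / (4 * (R + 1))"
      have d: "d > 0" using e R0 by (simp add: d_def)
      have Rd: "R * d \<le> e / 4" using e R0 by (simp add: d_def field_simps)
      obtain z where z: "z \<in> D" "z \<in> ball y d" using D(2)[of "ball y d"] d by auto
      have zd: "\<bar>f (k n) y - f (k n) z\<bar> \<le> e / 4" for n
      proof -
        have "\<bar>f (k n) y - f (k n) z\<bar> \<le> R * norm (y - z)" by (rule lipD)
        also have "\<dots> \<le> R * d" using z R0 by (intro mult_left_mono) (auto simp: dist_norm)
        finally show ?thesis using Rd by simp
      qed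
      have "Cauchy (\<lambda>n. f (k n) z)" using conv_D[OF z(1)] by (rule convergent_Cauchy)
      then obtain N where N: "\<And>m n. m \<ge> N \<Longrightarrow> n \<ge> N \<Longrightarrow> dist (f (k m) z) (f (k n) z) < e / 4"
        using e unfolding Cauchy_def by (metis zero_less_divide_iff zero_less_numeral)
      show "\<exists>M. \<forall>m\<ge>M. \<forall>n>m. dist (f (k m) y) (f (k n) y) < e"
      proof (intro exI allI impI)
        fix m n assume "m \<ge> N" "n > m"
        then have "dist (f (k m) z) (f (k n) z) < e / 4" using N[of m n] by simp
        with zd[of m] zd[of n] e show "dist (f (k m) y) (f (k n) y) < e"
          unfolding dist_real_def by linarith
      qed
    qed
    then show ?thesis by (simp add: Cauchy_convergent_iff)
  qed
  define g where "g y = lim (\<lambda>n. f (k n) y)" for y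
  have g: "(\<lambda>n. f (k n) y) \<longlonglongrightarrow> g y" for y
    using conv by (simp add: g_def convergent_LIMSEQ_iff)
  have "R-lipschitz_on UNIV g"
  proof (rule lipschitz_onI)
    fix x y
    have "(\<lambda>n. dist (f (k n) x) (f (k n) y)) \<longlonglongrightarrow> dist (g x) (g y)"
      by (intro tendsto_intros g)
    then show "dist (g x) (g y) \<le> R * dist x y"
      by (rule LIMSEQ_le_const2) (use lipschitz_onD[OF lip] in auto)
  qed (rule R0)
  with k(1) g show ?thesis by (intro that)
qed

text \<open>Only finitely many disjoint translates of a set of positive measure fit into a ball.\<close>

lemma null_sets_disjoint_translates:
  fixes A :: "'a::euclidean_space set"
  assumes A: "A \<in> sets borel" "A \<subseteq> cball 0 R" and i: "norm i \<le> 1"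
    and disj: "\<And>x t. x \<in> A \<Longrightarrow> x + t *\<^sub>R i \<in> A \<Longrightarrow> t \<in> \<rat> \<Longrightarrow> t = 0"
  shows "A \<in> null_sets lborel"
proof -
  \<comment> \<open>Translates of \<open>A\<close> along \<open>i\<close> by rational lengths at
    most one: they stay in one larger ball, and distinct lengths differ by a nonzero rational, so
    the translates are disjoint.\<close>
  define B where "B n = (\<lambda>x. x + (1 / real (Suc n)) *\<^sub>R i) -` A" for n
  have B_sets: "B n \<in> sets borel" for n
    unfolding B_def by (rule measurable_sets_borel[OF _ A(1)]) simp
  have B_meas: "emeasure lborel (B n) = emeasure lborel A" for n
  proof -
    have "emeasure lborel A = emeasure (distr lborel borel ((+) ((1 / real (Suc n)) *\<^sub>R i))) A"
      by (simp add: lborel_distr_plus)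
    also have "\<dots> = emeasure lborel ((+) ((1 / real (Suc n)) *\<^sub>R i) -` A)"
      by (subst emeasure_distr) (use A in auto)
    also have "(+) ((1 / real (Suc n)) *\<^sub>R i) -` A = B n" by (auto simp: B_def add.commute)
    finally show ?thesis by simp
  qed
  have sub: "B n \<subseteq> cball 0 (R + 1)" for n
  proof
    fix x assume "x \<in> B n"
    then have "norm (x + (1 / real (Suc n)) *\<^sub>R i) \<le> R" using A by (auto simp: B_def)
    moreover have "norm ((1 / real (Suc n)) *\<^sub>R i) \<le> 1"
      using i by (simp add: divide_simps)
    moreover have "norm x \<le> norm (x + (1 / real (Suc n)) *\<^sub>R i) + norm ((1 / real (Suc n)) *\<^sub>R i)"
      using norm_triangle_ineq4[of "x + (1 / real (Suc n)) *\<^sub>R i" "(1 / real (Suc n)) *\<^sub>R i"]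
      by (simp only: add_diff_cancel_right')
    ultimately show "x \<in> cball 0 (R + 1)" unfolding mem_cball_0 by linarith
  qed
  have "disjoint_family B"
    unfolding disjoint_family_on_def
  proof (intro ballI impI equals0I)
    fix m n :: nat and x assume mn: "m \<noteq> n" and x: "x \<in> B m \<inter> B n"
    define t where "t = 1 / real (Suc n) - 1 / real (Suc m)"
    have "x + (1 / real (Suc m)) *\<^sub>R i \<in> A" using x by (simp add: B_def)
    moreover have "(x + (1 / real (Suc m)) *\<^sub>R i) + t *\<^sub>R i \<in> A"
      using x by (simp add: B_def t_def algebra_simps)
    moreover have "t \<in> \<rat>" by (simp add: t_def)
    ultimately have "t = 0" by (rule disj)
    with mn show False by (simp add: t_def)
  qed
  then have sum: "(\<Sum>n. emeasure lborel (B n)) = emeasure lborel (\<Union>n. B n)"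
    using B_sets by (intro suminf_emeasure) auto
  have "emeasure lborel (\<Union>n. B n) \<le> emeasure lborel (cball 0 (R + 1) :: 'a set)"
    using sub by (intro emeasure_mono) auto
  also have "\<dots> < \<infinity>" by (intro emeasure_bounded_finite) auto
  finally have fin: "(\<Sum>n::nat. emeasure lborel A) < \<infinity>" using sum B_meas by simp
  have "emeasure lborel A = 0"
  proof (rule ccontr)
    assume "emeasure lborel A \<noteq> 0"
    \<comment> \<open>As counting measure times a constant, the series is infinite unless the
      constant vanishes.\<close>
    have "(\<Sum>n::nat. emeasure lborel A) = emeasure (count_space (UNIV::nat set)) UNIV * emeasure lborel A"
      by (simp add: nn_integral_count_space_nat[symmetric] mult.commute)
    with \<open>emeasure lborel A \<noteq> 0\<close> fin show False
      by (simp add: ennreal_top_mult)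
  qed
  with A show ?thesis by (auto intro: null_setsI)
qed

text \<open>Tail infima increase, so the supremum of their sums splits. This joins the two uses of
  Fatou's lemma in the dual functional.\<close>

lemma liminf_add_le_ennreal:
  fixes a b :: "nat \<Rightarrow> ennreal"
  shows "liminf a + liminf b \<le> liminf (\<lambda>n. a n + b n)"
proof -
  have inc: "incseq (\<lambda>n. INF m\<in>{n..}. f m)" for f :: "nat \<Rightarrow> ennreal"
    by (intro incseq_SucI INF_superset_mono) auto
  have "liminf a + liminf b = (SUP n. (INF m\<in>{n..}. a m) + (INF m\<in>{n..}. b m))"
    unfolding liminf_SUP_INF by (intro ennreal_SUP_add[symmetric] inc)
  also have "\<dots> \<le> (SUP n. INF m\<in>{n..}. a m + b m)"
    by (intro SUP_mono' INF_greatest add_mono INF_lower) auto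
  finally show ?thesis unfolding liminf_SUP_INF .
qed

section \<open>The Legendre transform\<close>

text \<open>A set \<open>C\<close> other than \<open>UNIV\<close> amounts to setting
  \<open>\<psi>\<close> to infinity outside \<open>C\<close>; comparison with the full transform
  detects whether a maximizer lies in \<open>C\<close>. Extended reals allow an infinite supremum
  and the value of an empty one.\<close>

definition legendre_on :: "'a::euclidean_space set \<Rightarrow> ('a \<Rightarrow> real) \<Rightarrow> 'a \<Rightarrow> ereal" where
  "legendre_on C \<psi> x = (SUP y\<in>C. ereal (x \<bullet> y - \<psi> y))"

abbreviation "legendre \<equiv> legendre_on UNIV"

lemma legendre_on_upper: "y \<in> C \<Longrightarrow> ereal (x \<bullet> y - \<psi> y) \<le> legendre_on C \<psi> x"
  unfolding legendre_on_def by (rule SUP_upper)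

lemma legendre_on_least: "(\<And>y. y \<in> C \<Longrightarrow> ereal (x \<bullet> y - \<psi> y) \<le> a) \<Longrightarrow> legendre_on C \<psi> x \<le> a"
  unfolding legendre_on_def by (rule SUP_least)

text \<open>A supremum of continuous functions is lower semicontinuous: its strict superlevel sets
  are unions of open sets, even over an uncountable \<open>C\<close>.\<close>

lemma legendre_on_measurable [measurable]: "legendre_on C \<psi> \<in> borel_measurable borel"
proof (rule borel_measurableI_greater)
  fix a
  have "{x \<in> space borel. a < legendre_on C \<psi> x} = (\<Union>y\<in>C. {x. a < ereal (x \<bullet> y - \<psi> y)})"
    by (auto simp: legendre_on_def less_SUP_iff)
  moreover have "open (\<Union>y\<in>C. {x. a < ereal (x \<bullet> y - \<psi> y)})"
    by (intro open_UN ballI open_Collect_less continuous_intros)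
  ultimately show "{x \<in> space borel. a < legendre_on C \<psi> x} \<in> sets borel" by simp
qed

lemma legendre_not_MInf: "legendre \<psi> x \<noteq> - \<infinity>"
  using legendre_on_upper[of 0 UNIV x \<psi>] by auto

lemma legendre_eq_real: "legendre \<psi> x \<noteq> \<infinity> \<Longrightarrow> legendre \<psi> x = ereal (real_of_ereal (legendre \<psi> x))"
  using legendre_not_MInf[of \<psi> x] by (cases "legendre \<psi> x") auto

lemma fenchel_young: "legendre \<psi> x \<noteq> \<infinity> \<Longrightarrow> x \<bullet> y - \<psi> y \<le> real_of_ereal (legendre \<psi> x)"
  using legendre_on_upper[of y UNIV x \<psi>] legendre_eq_real[of \<psi> x] by (metis UNIV_I ereal_less_eq(3))

lemma legendre_bound:
  assumes "\<And>y. x \<bullet> y - \<psi> y \<le> a"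
  shows "legendre \<psi> x \<noteq> \<infinity>" "real_of_ereal (legendre \<psi> x) \<le> a"
proof -
  have le: "legendre \<psi> x \<le> ereal a" using assms by (intro legendre_on_least) auto
  then show fin: "legendre \<psi> x \<noteq> \<infinity>" by auto
  from le show "real_of_ereal (legendre \<psi> x) \<le> a" by (subst (asm) legendre_eq_real[OF fin]) simp
qed

text \<open>For fixed \<open>y\<close> the left side is affine in the point because the weights sum
  to one. Since the bound holds for every \<open>y\<close>, it yields both convexity of the domain
  and convexity of the transform.\<close>

lemma legendre_convex_ineq:
  assumes "legendre \<psi> x \<noteq> \<infinity>" "legendre \<psi> z \<noteq> \<infinity>" "0 \<le> u" "0 \<le> v" "u + v = 1"
  shows "(u *\<^sub>R x + v *\<^sub>R z) \<bullet> y - \<psi> y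
    \<le> u * real_of_ereal (legendre \<psi> x) + v * real_of_ereal (legendre \<psi> z)"
proof -
  have "(u *\<^sub>R x + v *\<^sub>R z) \<bullet> y - \<psi> y = u * (x \<bullet> y - \<psi> y) + v * (z \<bullet> y - \<psi> y)"
  proof -
    have "\<psi> y = u * \<psi> y + v * \<psi> y" using assms(5) by (metis distrib_right mult_1)
    then show ?thesis by (simp add: inner_add_left algebra_simps)
  qed
  also have "\<dots> \<le> u * real_of_ereal (legendre \<psi> x) + v * real_of_ereal (legendre \<psi> z)"
    using assms by (intro add_mono mult_left_mono fenchel_young)
  finally show ?thesis .
qed

lemma convex_legendre_domain: "convex {x. legendre \<psi> x \<noteq> \<infinity>}"
  unfolding convex_def using legendre_bound(1)[OF legendre_convex_ineq] by blast

lemma convex_on_legendre: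
  assumes "convex S" "S \<subseteq> {x. legendre \<psi> x \<noteq> \<infinity>}"
  shows "convex_on S (\<lambda>x. real_of_ereal (legendre \<psi> x))"
  unfolding convex_on_def using assms legendre_bound(2)[OF legendre_convex_ineq] by blast

section \<open>Attainment of the supremum\<close>

text \<open>Finiteness of the transform near \<open>x\<close> makes \<open>\<psi> y - x \<bullet> y\<close> grow linearly in \<open>y\<close>.\<close>

lemma legendre_attained_on_closed:
  fixes \<psi> :: "'a::euclidean_space \<Rightarrow> real"
  assumes x: "x \<in> interior {x. legendre \<psi> x \<noteq> \<infinity>}" and cont: "continuous_on UNIV \<psi>"
    and C: "closed C" "C \<noteq> {}"
  obtains y where "y \<in> C" "legendre_on C \<psi> x = ereal (x \<bullet> y - \<psi> y)"
proof -
  define S where "S = interior {x. legendre \<psi> x \<noteq> \<infinity>}"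
  define p where "p x = real_of_ereal (legendre \<psi> x)" for x
  have S: "open S" "S \<subseteq> {x. legendre \<psi> x \<noteq> \<infinity>}" by (auto simp: S_def interior_subset)
  \<comment> \<open>A finite convex function on an open set is continuous, hence bounded on a closed
    ball around \<open>x\<close>.\<close>
  have cp: "continuous_on S p"
    unfolding p_def using S
    by (intro convex_on_continuous convex_on_legendre) (auto simp: S_def convex_interior convex_legendre_domain)
  obtain d where d: "d > 0" "cball x d \<subseteq> S" using S(1) x open_contains_cball unfolding S_def by blast
  have "compact (p ` cball x d)"
    using cp d by (intro compact_continuous_image) (auto intro: continuous_on_subset)
  then obtain B where B: "\<And>z. z \<in> cball x d \<Longrightarrow> p z \<le> B"
    by (metis bounded_imp_bdd_above cSup_upper compact_imp_bounded imageI)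
  have coer: "x \<bullet> y - \<psi> y \<le> B - d * norm y" for y
  proof -
    \<comment> \<open>A step of length \<open>d\<close> in the direction of \<open>y\<close> raises
      the inner product with \<open>y\<close> by \<open>d * norm y\<close>, while the transform at
      \<open>z\<close> stays below \<open>B\<close>. For \<open>y = 0\<close> the value
      \<open>sgn 0 = 0\<close> gives \<open>z = x\<close>.\<close>
    define z where "z = x + d *\<^sub>R sgn y"
    have z: "z \<in> cball x d" using d by (auto simp: z_def dist_norm norm_sgn)
    have "z \<bullet> y - \<psi> y \<le> p z"
      unfolding p_def using z d S by (intro fenchel_young) auto
    moreover have "z \<bullet> y = x \<bullet> y + d * norm y"
      by (cases "y = 0") (simp_all add: z_def inner_add_left sgn_div_norm dot_square_norm power2_eq_square)
    ultimately show ?thesis using B[OF z] by linarith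
  qed
  obtain y0 where y0: "y0 \<in> C" using C by auto
  \<comment> \<open>Beyond radius \<open>r\<close> the linear decay pushes the objective below its
    value at \<open>y0\<close>, so a maximum over the compact part of \<open>C\<close> is global.
    The term \<open>norm y0\<close> puts \<open>y0\<close> into that part.\<close>
  define r where "r = max (norm y0) ((B - (x \<bullet> y0 - \<psi> y0)) / d)"
  have "compact (C \<inter> cball 0 r)" using C by (simp add: closed_Int_compact)
  moreover have "y0 \<in> C \<inter> cball 0 r" using y0 by (simp add: r_def)
  moreover have "continuous_on (C \<inter> cball 0 r) (\<lambda>y. x \<bullet> y - \<psi> y)"
    by (intro continuous_intros continuous_on_subset[OF cont]) auto
  ultimately obtain y where y: "y \<in> C \<inter> cball 0 r"
    "\<And>z. z \<in> C \<inter> cball 0 r \<Longrightarrow> x \<bullet> z - \<psi> z \<le> x \<bullet> y - \<psi> y"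
    using continuous_attains_sup[of "C \<inter> cball 0 r" "\<lambda>y. x \<bullet> y - \<psi> y"] by blast
  have "x \<bullet> z - \<psi> z \<le> x \<bullet> y - \<psi> y" if "z \<in> C" for z
  proof (cases "norm z \<le> r")
    case True then show ?thesis using y(2) that by auto
  next
    case False
    then have "norm z > (B - (x \<bullet> y0 - \<psi> y0)) / d" by (simp add: r_def)
    then have "d * norm z > B - (x \<bullet> y0 - \<psi> y0)" using d(1) by (simp add: field_simps)
    then have "x \<bullet> z - \<psi> z \<le> x \<bullet> y0 - \<psi> y0" using coer[of z] by linarith
    also have "\<dots> \<le> x \<bullet> y - \<psi> y" using y(2) \<open>y0 \<in> C \<inter> cball 0 r\<close> by auto
    finally show ?thesis .
  qed
  then have "legendre_on C \<psi> x = ereal (x \<bullet> y - \<psi> y)"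
    using y(1) by (intro antisym legendre_on_least legendre_on_upper) auto
  with y(1) show ?thesis by (intro that) auto
qed

section \<open>Almost everywhere uniqueness of the maximizer\<close>

text \<open>Two maximizers over \<open>y\<close> at the same \<open>x\<close> force a kink of the transform along some coordinate
  direction, and on each line the kinks of a fixed slope and a fixed opening are isolated.\<close>

definition kinks :: "('a::euclidean_space \<Rightarrow> real) \<Rightarrow> 'a \<Rightarrow> real \<Rightarrow> nat \<Rightarrow> nat \<Rightarrow> 'a set" where
  "kinks \<psi> i q n r = {x. legendre \<psi> x \<noteq> \<infinity> \<and>
    (\<forall>t\<in>\<rat>. legendre \<psi> x + ereal (q * t + \<bar>t\<bar> / Suc n) \<le> legendre \<psi> (x + t *\<^sub>R i))} \<inter> cball 0 (real r)"

text \<open>Rational steps \<open>t\<close> make the set a countable intersection of Borel sets and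
  still cover the shifts needed for disjoint translates; the ball makes it bounded.\<close>

lemma kinks_null:
  fixes i :: "'a::euclidean_space"
  assumes i: "i \<in> Basis"
  shows "kinks \<psi> i q n r \<in> null_sets lborel"
proof (rule null_sets_disjoint_translates)
  show "kinks \<psi> i q n r \<subseteq> cball 0 (real r)" by (simp add: kinks_def)
  show "norm i \<le> 1" using i by simp
  have "kinks \<psi> i q n r = {x. legendre \<psi> x \<noteq> \<infinity>} \<inter>
    (\<Inter>t\<in>\<rat>. {x. legendre \<psi> x + ereal (q * t + \<bar>t\<bar> / Suc n) \<le> legendre \<psi> (x + t *\<^sub>R i)}) \<inter> cball 0 (real r)"
    by (auto simp: kinks_def)
  also have "\<dots> \<in> sets borel"
  proof (intro sets.Int sets.countable_INT')
    have "{x \<in> space borel. legendre \<psi> x \<noteq> \<infinity>} \<in> sets borel" by measurable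
    then show "{x. legendre \<psi> x \<noteq> \<infinity>} \<in> sets borel" by simp
    show "(\<rat> :: real set) \<noteq> {}" using Rats_0 by blast
    have "{x \<in> space borel. legendre \<psi> x + ereal (q * t + \<bar>t\<bar> / Suc n) \<le> legendre \<psi> (x + t *\<^sub>R i)} \<in> sets borel" for t
      by measurable
    then show "(\<lambda>t. {x. legendre \<psi> x + ereal (q * t + \<bar>t\<bar> / Suc n) \<le> legendre \<psi> (x + t *\<^sub>R i)}) ` \<rat> \<subseteq> sets borel"
      by auto
  qed (auto simp: countable_rat)
  finally show "kinks \<psi> i q n r \<in> sets borel" .
  fix x and t :: real assume x: "x \<in> kinks \<psi> i q n r" and xt: "x + t *\<^sub>R i \<in> kinks \<psi> i q n r" and t: "t \<in> \<rat>"
  obtain a where a: "legendre \<psi> x = ereal a" using x legendre_eq_real by (auto simp: kinks_def)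
  obtain b where b: "legendre \<psi> (x + t *\<^sub>R i) = ereal b" using xt legendre_eq_real by (auto simp: kinks_def)
  \<comment> \<open>Adding the inequality at \<open>x\<close> with step \<open>t\<close> to the one
    at the shifted point with step \<open>- t\<close> cancels the transforms and the slope
    \<open>q\<close>; twice the opening term remains and must be at most zero.\<close>
  have "legendre \<psi> x + ereal (q * t + \<bar>t\<bar> / Suc n) \<le> legendre \<psi> (x + t *\<^sub>R i)"
    using x t by (simp add: kinks_def)
  moreover have "legendre \<psi> (x + t *\<^sub>R i) + ereal (q * (- t) + \<bar>- t\<bar> / Suc n)
      \<le> legendre \<psi> ((x + t *\<^sub>R i) + (- t) *\<^sub>R i)"
    using xt Rats_minus_iff[of t] t unfolding kinks_def by blast
  ultimately have "a + (q * t + \<bar>t\<bar> / Suc n) \<le> b" "b + (q * (- t) + \<bar>- t\<bar> / Suc n) \<le> a"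
    by (simp_all add: a b)
  then have "\<bar>t\<bar> / Suc n \<le> 0" by simp
  then show "t = 0" by (simp add: divide_le_0_iff)
qed

text \<open>This plays the role of almost everywhere differentiability of convex functions.
  Maximizers are subgradients of the transform, so two of them that differ in coordinate
  \<open>i\<close> leave room for a rational slope \<open>q\<close> between them with margin
  \<open>1 / (n + 1)\<close>. The point then lies in one of countably many null sets.\<close>

lemma legendre_maximizer_unique:
  fixes \<psi> :: "'a::euclidean_space \<Rightarrow> real"
  shows "\<exists>K\<in>null_sets lborel. \<forall>x y z. x \<notin> K \<longrightarrow> legendre \<psi> x = ereal (x \<bullet> y - \<psi> y) \<longrightarrow>
    legendre \<psi> x = ereal (x \<bullet> z - \<psi> z) \<longrightarrow> y = z"
proof -
  define K where "K = (\<Union>i\<in>Basis. \<Union>q\<in>\<rat>. \<Union>n. \<Union>r. kinks \<psi> i q n r)"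
  have K: "K \<in> null_sets lborel"
    unfolding K_def
    by (rule null_sets_UN'[OF countable_finite[OF finite_Basis]], rule null_sets_UN'[OF countable_rat],
        rule null_sets_UN, rule null_sets_UN, rule kinks_null)
  have "y = z" if x: "x \<notin> K" and y: "legendre \<psi> x = ereal (x \<bullet> y - \<psi> y)"
    and z: "legendre \<psi> x = ereal (x \<bullet> z - \<psi> z)" for x y z
  proof (rule ccontr)
    assume "y \<noteq> z"
    then obtain i where i: "i \<in> Basis" and ne: "y \<bullet> i \<noteq> z \<bullet> i" using euclidean_eqI by blast
    have main: "x \<in> K" if y: "legendre \<psi> x = ereal (x \<bullet> y - \<psi> y)"
      and z: "legendre \<psi> x = ereal (x \<bullet> z - \<psi> z)" and less: "y \<bullet> i < z \<bullet> i" for y z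
    proof -
      obtain q where q: "q \<in> \<rat>" "y \<bullet> i < q" "q < z \<bullet> i" using Rats_dense_in_real[OF less] by blast
      then have "0 < min (q - y \<bullet> i) (z \<bullet> i - q)" by simp
      then obtain n where n: "1 / real (Suc n) < min (q - y \<bullet> i) (z \<bullet> i - q)"
        using nat_approx_posE by blast
      obtain r where r: "norm x \<le> real r" using real_arch_simple by blast
      have "legendre \<psi> x + ereal (q * t + \<bar>t\<bar> / Suc n) \<le> legendre \<psi> (x + t *\<^sub>R i)" for t
      proof -
        have step: "legendre \<psi> x + ereal (t * (w \<bullet> i)) \<le> legendre \<psi> (x + t *\<^sub>R i)"
          if "legendre \<psi> x = ereal (x \<bullet> w - \<psi> w)" for w
          using legendre_on_upper[of w UNIV "x + t *\<^sub>R i" \<psi>]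
          by (simp add: that inner_add_left inner_commute algebra_simps)
        \<comment> \<open>For \<open>t \<ge> 0\<close> the maximizer with the larger coordinate
          gives the bound, for negative \<open>t\<close> the one with the smaller
          coordinate.\<close>
        have "\<exists>w\<in>{y, z}. q * t + \<bar>t\<bar> / Suc n \<le> t * (w \<bullet> i)"
        proof (cases "t \<ge> 0")
          case True
          have "t * (q + 1 / Suc n) \<le> t * (z \<bullet> i)" using n True by (intro mult_left_mono) auto
          then show ?thesis using True by (simp add: algebra_simps)
        next
          case False
          have "(- t) * (y \<bullet> i) \<le> (- t) * (q - 1 / Suc n)" using n False by (intro mult_left_mono) auto
          then show ?thesis using False by (simp add: algebra_simps)
        qed
        then obtain w where w: "w \<in> {y, z}" "q * t + \<bar>t\<bar> / Suc n \<le> t * (w \<bullet> i)" by blast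
        have "legendre \<psi> x + ereal (q * t + \<bar>t\<bar> / Suc n) \<le> legendre \<psi> x + ereal (t * (w \<bullet> i))"
          using w(2) by (intro add_left_mono) simp
        also have "\<dots> \<le> legendre \<psi> (x + t *\<^sub>R i)" using w(1) y z by (intro step) auto
        finally show ?thesis .
      qed
      then have "x \<in> kinks \<psi> i q n r" using r y by (simp add: kinks_def)
      then show "x \<in> K" using i q(1) unfolding K_def by blast
    qed
    show False using main[OF y z] main[OF z y] ne x by linarith
  qed
  with K show ?thesis by blast
qed

section \<open>The dual problem and Brenier's theorem\<close>

text \<open>The radius \<open>R\<close> bounds the slopes of the potentials, which therefore grow at
  most like \<open>R * norm y\<close>; the first moment of \<open>N\<close> makes them
  integrable.\<close>

locale dual_transport =
  M: prob_space M + N: prob_space N for M N :: "'a::euclidean_space measure" +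
  fixes R :: real
  assumes sets_M [measurable_cong]: "sets M = sets borel"
    and sets_N [measurable_cong]: "sets N = sets borel"
    and R_nonneg: "0 \<le> R"
    and bounded_M: "AE x in M. norm x \<le> R"
    and first_moment_N: "integrable N norm"
begin

lemma space_M [simp]: "space M = UNIV" and space_N [simp]: "space N = UNIV"
  using sets_M sets_N by (metis sets_eq_imp_space_eq space_borel)+

lemma prob_UNIV [simp]: "measure M UNIV = 1" "measure N UNIV = 1"
  using M.prob_space N.prob_space by simp_all

section \<open>The dual functional on Lipschitz potentials\<close>

definition potentials :: "('a \<Rightarrow> real) set" where
  "potentials = {\<psi>. R-lipschitz_on UNIV \<psi> \<and> \<psi> 0 = 0}"

text \<open>The term \<open>R * norm y\<close> only adds a constant and makes both integrands nonnegative.\<close>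

definition dual_cost :: "('a \<Rightarrow> real) \<Rightarrow> ennreal" where
  "dual_cost \<psi> = (\<integral>\<^sup>+x. e2ennreal (legendre \<psi> x) \<partial>M) + (\<integral>\<^sup>+y. ennreal (\<psi> y + R * norm y) \<partial>N)"

lemma potential_abs_le: "\<psi> \<in> potentials \<Longrightarrow> \<bar>\<psi> y\<bar> \<le> R * norm y"
  using lipschitz_onD[of R UNIV \<psi> y 0] by (simp add: potentials_def dist_norm)

lemma potential_continuous: "\<psi> \<in> potentials \<Longrightarrow> continuous_on UNIV \<psi>"
  using lipschitz_on_continuous_on by (auto simp: potentials_def)

lemma potential_measurable [measurable_dest]: "\<psi> \<in> potentials \<Longrightarrow> \<psi> \<in> borel_measurable borel"
  using potential_continuous by (rule borel_measurable_continuous_onI)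

lemma potential_integrable: "\<psi> \<in> potentials \<Longrightarrow> integrable N \<psi>"
proof (rule Bochner_Integration.integrable_bound)
  show "integrable N (\<lambda>y. R * norm y)" using first_moment_N by simp
qed (use potential_abs_le R_nonneg in \<open>auto intro!: AE_I2\<close>)

lemma potential_nn_integral:
  assumes "\<psi> \<in> potentials"
  shows "(\<integral>\<^sup>+y. ennreal (\<psi> y + R * norm y) \<partial>N) = ennreal ((\<integral>y. \<psi> y \<partial>N) + R * (\<integral>y. norm y \<partial>N))"
    "0 \<le> (\<integral>y. \<psi> y \<partial>N) + R * (\<integral>y. norm y \<partial>N)"
proof -
  have nn: "0 \<le> \<psi> y + R * norm y" for y using potential_abs_le[OF assms, of y] by linarith
  have int: "(\<integral>y. \<psi> y + R * norm y \<partial>N) = (\<integral>y. \<psi> y \<partial>N) + R * (\<integral>y. norm y \<partial>N)"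
    using potential_integrable[OF assms] first_moment_N by simp
  show "(\<integral>\<^sup>+y. ennreal (\<psi> y + R * norm y) \<partial>N) = ennreal ((\<integral>y. \<psi> y \<partial>N) + R * (\<integral>y. norm y \<partial>N))"
    using potential_integrable[OF assms] first_moment_N nn
    by (subst nn_integral_eq_integral) (auto simp: int)
  show "0 \<le> (\<integral>y. \<psi> y \<partial>N) + R * (\<integral>y. norm y \<partial>N)"
    unfolding int[symmetric] using nn by (rule Bochner_Integration.integral_nonneg)
qed

text \<open>The point \<open>0\<close>, where \<open>\<psi>\<close> vanishes, competes in the
  supremum. Hence \<open>e2ennreal\<close> in \<open>dual_cost\<close> truncates nothing.\<close>

lemma legendre_potential_nonneg: "\<psi> \<in> potentials \<Longrightarrow> 0 \<le> legendre \<psi> x"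
  using legendre_on_upper[of 0 UNIV x \<psi>] by (simp add: potentials_def zero_ereal_def)

text \<open>For each \<open>y\<close> the affine function in the supremum converges, so the
  transform of the limit is at most the pointwise lower limit of the transforms. Fatou's lemma
  integrates this, and handles the second integral as well.\<close>

lemma dual_cost_lsc:
  assumes "\<And>n. f n \<in> potentials" "\<And>y. (\<lambda>n. f n y) \<longlonglongrightarrow> g y" "g \<in> potentials"
  shows "dual_cost g \<le> liminf (\<lambda>n. dual_cost (f n))"
proof -
  note [measurable] = assms(1,3)[THEN potential_measurable]
  have 1: "e2ennreal (legendre g x) \<le> liminf (\<lambda>n. e2ennreal (legendre (f n) x))" for x
  proof -
    let ?l = "liminf (\<lambda>n. e2ennreal (legendre (f n) x))"
    have "ereal (x \<bullet> y - g y) \<le> enn2ereal ?l" for y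
    proof -
      have "(\<lambda>n. ennreal (x \<bullet> y - f n y)) \<longlonglongrightarrow> ennreal (x \<bullet> y - g y)"
        by (intro tendsto_intros assms)
      then have "ennreal (x \<bullet> y - g y) = liminf (\<lambda>n. ennreal (x \<bullet> y - f n y))"
        by (simp add: lim_imp_Liminf)
      also have "\<dots> \<le> ?l"
      proof (intro Liminf_mono always_eventually allI)
        fix n
        have "e2ennreal (ereal (x \<bullet> y - f n y)) \<le> e2ennreal (legendre (f n) x)"
          by (intro e2ennreal_mono legendre_on_upper) auto
        then show "ennreal (x \<bullet> y - f n y) \<le> e2ennreal (legendre (f n) x)"
          by simp
      qed
      finally have "enn2ereal (ennreal (x \<bullet> y - g y)) \<le> enn2ereal ?l"
        by (simp add: less_eq_ennreal.rep_eq)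
      \<comment> \<open>\<open>ennreal\<close> raises negative values to zero, so the truncated
        value still bounds the real one from above.\<close>
      moreover have "ereal (x \<bullet> y - g y) \<le> enn2ereal (ennreal (x \<bullet> y - g y))"
        by (simp add: ennreal.rep_eq)
      ultimately show ?thesis by (rule order_trans[rotated])
    qed
    then have "legendre g x \<le> enn2ereal ?l" by (intro legendre_on_least) auto
    then have "e2ennreal (legendre g x) \<le> e2ennreal (enn2ereal ?l)" by (rule e2ennreal_mono)
    then show ?thesis by simp
  qed
  have "(\<integral>\<^sup>+x. e2ennreal (legendre g x) \<partial>M) \<le> (\<integral>\<^sup>+x. liminf (\<lambda>n. e2ennreal (legendre (f n) x)) \<partial>M)"
    by (intro nn_integral_mono 1)
  also have "\<dots> \<le> liminf (\<lambda>n. \<integral>\<^sup>+x. e2ennreal (legendre (f n) x) \<partial>M)"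
    by (rule nn_integral_liminf) measurable
  finally have A: "(\<integral>\<^sup>+x. e2ennreal (legendre g x) \<partial>M) \<le> liminf (\<lambda>n. \<integral>\<^sup>+x. e2ennreal (legendre (f n) x) \<partial>M)" .
  have 2: "ennreal (g y + R * norm y) = liminf (\<lambda>n. ennreal (f n y + R * norm y))" for y
  proof -
    have "(\<lambda>n. ennreal (f n y + R * norm y)) \<longlonglongrightarrow> ennreal (g y + R * norm y)"
      by (intro tendsto_intros assms)
    then show ?thesis by (simp add: lim_imp_Liminf)
  qed
  have "(\<integral>\<^sup>+y. ennreal (g y + R * norm y) \<partial>N) \<le> liminf (\<lambda>n. \<integral>\<^sup>+y. ennreal (f n y + R * norm y) \<partial>N)"
    unfolding 2 by (rule nn_integral_liminf) measurable
  with A have "dual_cost g \<le> liminf (\<lambda>n. \<integral>\<^sup>+x. e2ennreal (legendre (f n) x) \<partial>M)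
      + liminf (\<lambda>n. \<integral>\<^sup>+y. ennreal (f n y + R * norm y) \<partial>N)"
    unfolding dual_cost_def by (rule add_mono)
  also have "\<dots> \<le> liminf (\<lambda>n. dual_cost (f n))"
    unfolding dual_cost_def by (rule liminf_add_le_ennreal)
  finally show ?thesis .
qed

section \<open>Existence of a dual minimizer\<close>

lemma norm_potential: "(\<lambda>y. R * norm y) \<in> potentials"
proof -
  have "R-lipschitz_on UNIV (\<lambda>y::'a. R * norm y)"
  proof (rule lipschitz_onI)
    fix x y :: 'a
    have "dist (R * norm x) (R * norm y) = R * \<bar>norm x - norm y\<bar>"
      using R_nonneg by (simp add: dist_real_def abs_mult flip: right_diff_distrib)
    also have "\<dots> \<le> R * dist x y"
      using R_nonneg by (intro mult_left_mono) (auto simp: dist_norm norm_triangle_ineq3)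
    finally show "dist (R * norm x) (R * norm y) \<le> R * dist x y" .
  qed (rule R_nonneg)
  then show ?thesis by (simp add: potentials_def)
qed

text \<open>By the Cauchy-Schwarz inequality the transform of \<open>R * norm y\<close> is
  nonpositive on the ball that carries \<open>M\<close>, so only the \<open>N\<close>-integral
  remains. The infimum of the dual problem is thus finite.\<close>

lemma dual_cost_norm_finite: "dual_cost (\<lambda>y. R * norm y) < \<infinity>"
proof -
  have "AE x in M. e2ennreal (legendre (\<lambda>y::'a. R * norm y) x) = 0"
    using bounded_M
  proof eventually_elim
    fix x :: 'a assume x: "norm x \<le> R"
    have "legendre (\<lambda>y. R * norm y) x \<le> 0"
    proof (rule legendre_on_least)
      fix y
      have "x \<bullet> y \<le> norm x * norm y" by (rule norm_cauchy_schwarz)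
      also have "\<dots> \<le> R * norm y" using x by (intro mult_right_mono) auto
      finally show "ereal (x \<bullet> y - R * norm y) \<le> 0" by simp
    qed
    then show "e2ennreal (legendre (\<lambda>y. R * norm y) x) = 0" by (rule e2ennreal_neg)
  qed
  then have "(\<integral>\<^sup>+x. e2ennreal (legendre (\<lambda>y. R * norm y) x) \<partial>M) = (\<integral>\<^sup>+x. 0 \<partial>M)"
    by (rule nn_integral_cong_AE)
  then show ?thesis
    unfolding dual_cost_def potential_nn_integral[OF norm_potential] by simp
qed

text \<open>The direct method: a minimizing sequence has a pointwise convergent subsequence, and
  lower semicontinuity makes its limit a minimizer.\<close>

lemma dual_cost_attained:
  obtains \<psi> where "\<psi> \<in> potentials" "\<And>g. g \<in> potentials \<Longrightarrow> dual_cost \<psi> \<le> dual_cost g"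
proof -
  have "dual_cost ` potentials \<noteq> {}" using norm_potential by auto
  from Inf_as_limit[OF this] obtain u where
    "\<And>n. u n \<in> dual_cost ` potentials" and u: "u \<longlonglongrightarrow> Inf (dual_cost ` potentials)"
    by blast
  then obtain f where f: "\<And>n. f n \<in> potentials" "\<And>n. u n = dual_cost (f n)"
    unfolding image_iff by metis
  have lip: "R-lipschitz_on UNIV (f n)" and zero: "f n 0 = 0" for n
    using f(1)[of n] by (simp_all add: potentials_def)
  obtain k g where k: "strict_mono (k :: nat \<Rightarrow> nat)" and g: "R-lipschitz_on UNIV g"
    and lim: "\<And>y. (\<lambda>n. f (k n) y) \<longlonglongrightarrow> g y"
    by (rule lipschitz_convergent_subsequence[of R f, OF lip zero]) (rule that)
  have "(\<lambda>n. f (k n) 0) \<longlonglongrightarrow> 0" by (simp add: zero)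
  with lim[of 0] have "g 0 = 0" using LIMSEQ_unique by blast
  with g have gp: "g \<in> potentials" by (simp add: potentials_def)
  have "dual_cost g \<le> liminf (\<lambda>n. dual_cost (f (k n)))"
    using f lim gp by (intro dual_cost_lsc)
  also have "\<dots> = Inf (dual_cost ` potentials)"
    using LIMSEQ_subseq_LIMSEQ[OF u k] f(2) by (intro lim_imp_Liminf) (auto simp: o_def)
  finally have "dual_cost g \<le> Inf (dual_cost ` potentials)" .
  then show ?thesis using gp by (intro that[of g]) (auto simp: le_INF_iff)
qed

section \<open>Minimality among all integrable dual pairs\<close>

text \<open>Conjugating \<open>f\<close> over a part of the ball of full measure gives a function
  below \<open>g\<close> whose slopes are bounded by \<open>R\<close>, and the transform of that
  function stays below \<open>f\<close> there. Every integrable dual pair is thus matched or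
  improved by a potential.\<close>

lemma potential_competitor:
  assumes D: "AE x in M. x \<in> D" and f: "integrable M f" and g: "integrable N g"
    and le: "\<And>x y. x \<in> D \<Longrightarrow> x \<bullet> y \<le> f x + g y"
  obtains \<psi> where "\<psi> \<in> potentials"
    "dual_cost \<psi> \<le> ennreal ((\<integral>x. f x \<partial>M) + (\<integral>y. g y \<partial>N) + R * (\<integral>y. norm y \<partial>N))"
    "0 \<le> (\<integral>x. f x \<partial>M) + (\<integral>y. g y \<partial>N) + R * (\<integral>y. norm y \<partial>N)"
proof -
  define E where "E = D \<inter> cball 0 R"
  have E: "AE x in M. x \<in> E"
    using D bounded_M by eventually_elim (auto simp: E_def)
  obtain x0 where x0: "x0 \<in> E"
  proof -
    have "E \<noteq> {}"
    proof
      assume "E = {}"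
      with E show False by simp
    qed
    then show ?thesis using that by auto
  qed
  \<comment> \<open>The value \<open>g y\<close> bounds the family, so the real-valued supremum
    \<open>h y\<close> is a genuine one.\<close>
  have bdd: "bdd_above ((\<lambda>x. x \<bullet> y - f x) ` E)" for y
    using le by (intro bdd_aboveI[of _ "g y"]) (auto simp: E_def algebra_simps)
  define h where "h y = (SUP x\<in>E. x \<bullet> y - f x)" for y
  have h_upper: "x \<bullet> y - f x \<le> h y" if "x \<in> E" for x y
    unfolding h_def using that bdd by (intro cSUP_upper)
  have h_least: "h y \<le> a" if "\<And>x. x \<in> E \<Longrightarrow> x \<bullet> y - f x \<le> a" for y a
    unfolding h_def using that x0 by (intro cSUP_least) auto
  have lip1: "h y \<le> h z + R * norm (y - z)" for y z
  proof (rule h_least)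
    fix x assume x: "x \<in> E"
    have "x \<bullet> y = x \<bullet> z + x \<bullet> (y - z)" by (simp add: inner_diff_right)
    also have "x \<bullet> (y - z) \<le> norm x * norm (y - z)" by (rule norm_cauchy_schwarz)
    also have "\<dots> \<le> R * norm (y - z)" using x by (intro mult_right_mono) (auto simp: E_def)
    finally show "x \<bullet> y - f x \<le> h z + R * norm (y - z)" using h_upper[OF x, of z] by linarith
  qed
  \<comment> \<open>Normalizing at \<open>0\<close> adds \<open>h 0\<close> to the bound on the
    transform and subtracts it from the bound on the potential; the two cancel in the sum of
    integrals.\<close>
  define \<psi> where "\<psi> y = h y - h 0" for y
  have "R-lipschitz_on UNIV \<psi>"
  proof (rule lipschitz_onI)
    fix y z show "dist (\<psi> y) (\<psi> z) \<le> R * dist y z"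
      using lip1[of y z] lip1[of z y] by (auto simp: \<psi>_def dist_norm norm_minus_commute abs_if)
  qed (rule R_nonneg)
  then have \<psi>: "\<psi> \<in> potentials" by (simp add: potentials_def \<psi>_def)
  have nn: "AE x in M. 0 \<le> f x + h 0"
    using E
  proof eventually_elim
    fix x assume "x \<in> E"
    from h_upper[OF this, of 0] show "0 \<le> f x + h 0" by simp
  qed
  have "(\<integral>\<^sup>+x. e2ennreal (legendre \<psi> x) \<partial>M) \<le> (\<integral>\<^sup>+x. ennreal (f x + h 0) \<partial>M)"
  proof (rule nn_integral_mono_AE)
    show "AE x in M. e2ennreal (legendre \<psi> x) \<le> ennreal (f x + h 0)"
      using E
    proof eventually_elim
      fix x assume x: "x \<in> E"
      have "legendre \<psi> x \<le> ereal (f x + h 0)"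
        by (rule legendre_on_least) (use h_upper[OF x] in \<open>simp add: \<psi>_def algebra_simps\<close>)
      then have "e2ennreal (legendre \<psi> x) \<le> e2ennreal (ereal (f x + h 0))" by (rule e2ennreal_mono)
      then show "e2ennreal (legendre \<psi> x) \<le> ennreal (f x + h 0)" by simp
    qed
  qed
  also have "\<dots> = ennreal (\<integral>x. f x + h 0 \<partial>M)"
    using f nn by (intro nn_integral_eq_integral) auto
  also have "(\<integral>x. f x + h 0 \<partial>M) = (\<integral>x. f x \<partial>M) + h 0"
    using f by simp
  finally have 1: "(\<integral>\<^sup>+x. e2ennreal (legendre \<psi> x) \<partial>M) \<le> ennreal ((\<integral>x. f x \<partial>M) + h 0)" .
  have nn1: "0 \<le> (\<integral>x. f x \<partial>M) + h 0"
  proof -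
    have "0 \<le> (\<integral>x. f x + h 0 \<partial>M)" using nn by (intro integral_nonneg_AE)
    then show ?thesis using f by simp
  qed
  have "(\<integral>y. \<psi> y \<partial>N) \<le> (\<integral>y. g y - h 0 \<partial>N)"
  proof (rule integral_mono)
    fix y
    have "h y \<le> g y" by (rule h_least) (use le in \<open>auto simp: E_def algebra_simps\<close>)
    then show "\<psi> y \<le> g y - h 0" by (simp add: \<psi>_def)
  qed (use potential_integrable[OF \<psi>] g in auto)
  also have "\<dots> = (\<integral>y. g y \<partial>N) - h 0" using g by simp
  finally have 2: "(\<integral>y. \<psi> y \<partial>N) \<le> (\<integral>y. g y \<partial>N) - h 0" .
  have "dual_cost \<psi> \<le> ennreal ((\<integral>x. f x \<partial>M) + h 0)
      + ennreal ((\<integral>y. \<psi> y \<partial>N) + R * (\<integral>y. norm y \<partial>N))"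
    unfolding dual_cost_def potential_nn_integral[OF \<psi>] by (rule add_right_mono[OF 1])
  also have "\<dots> = ennreal (((\<integral>x. f x \<partial>M) + h 0) + ((\<integral>y. \<psi> y \<partial>N) + R * (\<integral>y. norm y \<partial>N)))"
    using nn1 potential_nn_integral(2)[OF \<psi>] by (rule ennreal_plus[symmetric])
  also have "\<dots> \<le> ennreal ((\<integral>x. f x \<partial>M) + (\<integral>y. g y \<partial>N) + R * (\<integral>y. norm y \<partial>N))"
    using 2 by (intro ennreal_leI) linarith
  finally show ?thesis
    using \<psi> nn1 2 potential_nn_integral(2)[OF \<psi>] by (intro that) auto
qed

text \<open>Minimality is extended from Lipschitz potentials to arbitrary integrable pairs because
  the perturbation by an indicator, used later, leaves the Lipschitz class. The constant from
  \<open>R * norm y\<close> cancels on both sides.\<close>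

lemma dual_minimizer:
  obtains \<psi> where "\<psi> \<in> potentials" "AE x in M. legendre \<psi> x \<noteq> \<infinity>"
    "integrable M (\<lambda>x. real_of_ereal (legendre \<psi> x))"
    "\<forall>D f g. (AE x in M. x \<in> D) \<longrightarrow> integrable M f \<longrightarrow> integrable N g \<longrightarrow>
      (\<forall>x\<in>D. \<forall>y. x \<bullet> y \<le> f x + g y) \<longrightarrow>
      (\<integral>x. real_of_ereal (legendre \<psi> x) \<partial>M) + (\<integral>y. \<psi> y \<partial>N) \<le> (\<integral>x. f x \<partial>M) + (\<integral>y. g y \<partial>N)"
proof -
  obtain \<psi> where \<psi>: "\<psi> \<in> potentials" and min: "\<And>g. g \<in> potentials \<Longrightarrow> dual_cost \<psi> \<le> dual_cost g"
    using dual_cost_attained by blast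
  define p where "p x = real_of_ereal (legendre \<psi> x)" for x
  have [measurable]: "p \<in> borel_measurable borel" unfolding p_def by measurable
  have p_nn: "0 \<le> p x" for x
    unfolding p_def using legendre_potential_nonneg[OF \<psi>] by (rule real_of_ereal_pos)
  have "dual_cost \<psi> < \<infinity>" using min[OF norm_potential] dual_cost_norm_finite by (rule le_less_trans)
  then have fin: "(\<integral>\<^sup>+x. e2ennreal (legendre \<psi> x) \<partial>M) < \<infinity>"
    unfolding dual_cost_def by simp
  then have "AE x in M. e2ennreal (legendre \<psi> x) \<noteq> \<infinity>"
    by (intro nn_integral_PInf_AE) auto
  then have AE_fin: "AE x in M. legendre \<psi> x \<noteq> \<infinity>"
    by eventually_elim auto
  have nn_p: "(\<integral>\<^sup>+x. e2ennreal (legendre \<psi> x) \<partial>M) = (\<integral>\<^sup>+x. ennreal (p x) \<partial>M)"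
  proof (rule nn_integral_cong_AE)
    show "AE x in M. e2ennreal (legendre \<psi> x) = ennreal (p x)"
      using AE_fin
      by eventually_elim (metis p_def legendre_eq_real e2ennreal_ereal)
  qed
  have int_p: "integrable M p"
    using fin p_nn unfolding nn_p by (intro integrableI_nonneg) auto
  have p_int_nn: "0 \<le> (\<integral>x. p x \<partial>M)" using p_nn by simp
  have cost: "dual_cost \<psi> = ennreal ((\<integral>x. p x \<partial>M) + (\<integral>y. \<psi> y \<partial>N) + R * (\<integral>y. norm y \<partial>N))"
  proof -
    have "dual_cost \<psi> = ennreal (\<integral>x. p x \<partial>M) + ennreal ((\<integral>y. \<psi> y \<partial>N) + R * (\<integral>y. norm y \<partial>N))"
      unfolding dual_cost_def potential_nn_integral[OF \<psi>] nn_p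
      using int_p p_nn by (subst nn_integral_eq_integral) auto
    also have "\<dots> = ennreal ((\<integral>x. p x \<partial>M) + ((\<integral>y. \<psi> y \<partial>N) + R * (\<integral>y. norm y \<partial>N)))"
      using p_int_nn potential_nn_integral(2)[OF \<psi>] by (rule ennreal_plus[symmetric])
    finally show ?thesis by (simp add: add.assoc)
  qed
  show ?thesis
  proof (rule that[OF \<psi> AE_fin int_p[unfolded p_def]], intro allI impI)
    fix D f g
    assume *: "AE x in M. x \<in> D" "integrable M f" "integrable N g"
      "\<forall>x\<in>D. \<forall>y. x \<bullet> y \<le> f x + g y"
    obtain h where h: "h \<in> potentials"
      "dual_cost h \<le> ennreal ((\<integral>x. f x \<partial>M) + (\<integral>y. g y \<partial>N) + R * (\<integral>y. norm y \<partial>N))"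
      "0 \<le> (\<integral>x. f x \<partial>M) + (\<integral>y. g y \<partial>N) + R * (\<integral>y. norm y \<partial>N)"
      using potential_competitor[OF *(1-3)] *(4) by blast
    have "ennreal ((\<integral>x. p x \<partial>M) + (\<integral>y. \<psi> y \<partial>N) + R * (\<integral>y. norm y \<partial>N))
        \<le> ennreal ((\<integral>x. f x \<partial>M) + (\<integral>y. g y \<partial>N) + R * (\<integral>y. norm y \<partial>N))"
      unfolding cost[symmetric] using min[OF h(1)] h(2) by (rule order_trans)
    then show "(\<integral>x. real_of_ereal (legendre \<psi> x) \<partial>M) + (\<integral>y. \<psi> y \<partial>N)
        \<le> (\<integral>x. f x \<partial>M) + (\<integral>y. g y \<partial>N)"
      \<comment> \<open>Nonnegativity of the competing value rules out that \<open>ennreal\<close>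
        truncates it, so the inequality descends to the reals.\<close>
      using h(3) unfolding p_def by (simp add: ennreal_le_iff)
  qed
qed

section \<open>First variation and the Brenier map\<close>

text \<open>The optimal potential is tested against its perturbations \<open>\<psi> - \<epsilon> * indicator C\<close>: as \<open>\<epsilon> \<rightarrow> 0\<close>,
  the transform grows at the rate \<open>1\<close> where the maximizer lies in \<open>C\<close> and stays put elsewhere.\<close>

lemma brenier:
  assumes ac: "absolutely_continuous lborel M"
  obtains T f g where "T \<in> borel_measurable borel" "distr M borel T = N"
    "integrable M f" "integrable N g"
    "AE x in M. \<forall>y. x \<bullet> y \<le> f x + g y \<and> (x \<bullet> y = f x + g y \<longleftrightarrow> y = T x)"
proof -
  obtain \<psi> where \<psi>: "\<psi> \<in> potentials" and fin: "AE x in M. legendre \<psi> x \<noteq> \<infinity>"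
    and int: "integrable M (\<lambda>x. real_of_ereal (legendre \<psi> x))"
    and min: "\<forall>D f g. (AE x in M. x \<in> D) \<longrightarrow> integrable M f \<longrightarrow> integrable N g \<longrightarrow>
      (\<forall>x\<in>D. \<forall>y. x \<bullet> y \<le> f x + g y) \<longrightarrow>
      (\<integral>x. real_of_ereal (legendre \<psi> x) \<partial>M) + (\<integral>y. \<psi> y \<partial>N) \<le> (\<integral>x. f x \<partial>M) + (\<integral>y. g y \<partial>N)"
    by (rule dual_minimizer) (rule that)
  note cont = potential_continuous[OF \<psi>]
  define p where "p x = real_of_ereal (legendre \<psi> x)" for x
  define dom where "dom = {x. legendre \<psi> x \<noteq> \<infinity>}"
  note AE_M = absolutely_continuous_AE[OF _ ac, simplified, OF sets_M]
  \<comment> \<open>The boundary of a convex set is Lebesgue null, so absolute continuity places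
    almost every point in the interior of the domain, where suprema over nonempty closed sets are
    attained.\<close>
  have "negligible (frontier dom)"
    unfolding dom_def by (intro negligible_convex_frontier convex_legendre_domain)
  then have "AE x in lborel. x \<notin> frontier dom"
    unfolding negligible_iff_null_sets by (metis AE_completion_iff AE_not_in)
  then have "AE x in M. x \<notin> frontier dom" by (rule AE_M)
  with fin have AE_int: "AE x in M. x \<in> interior dom"
    by eventually_elim (use closure_subset[of dom] in \<open>auto simp: frontier_def dom_def\<close>)
  obtain K where K: "K \<in> null_sets lborel" and uniq: "\<And>x y z. x \<notin> K \<Longrightarrow>
      legendre \<psi> x = ereal (x \<bullet> y - \<psi> y) \<Longrightarrow> legendre \<psi> x = ereal (x \<bullet> z - \<psi> z) \<Longrightarrow> y = z"
    using legendre_maximizer_unique[of \<psi>] by metis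
  \<comment> \<open>The interior provides existence of a maximizer, the complement of
    \<open>K\<close> its uniqueness.\<close>
  define D where "D = interior dom - K"
  have D_sets [measurable]: "D \<in> sets borel"
    using K unfolding D_def by (intro sets.Diff) auto
  have AE_D: "AE x in M. x \<in> D"
    using AE_int AE_M[OF AE_not_in[OF K]] by eventually_elim (auto simp: D_def)
  have D_fin: "legendre \<psi> x \<noteq> \<infinity>" if "x \<in> D" for x
    using that interior_subset[of dom] by (auto simp: D_def dom_def)
  have attained: "\<exists>y\<in>C. legendre_on C \<psi> x = ereal (x \<bullet> y - \<psi> y)"
    if "x \<in> D" "closed C" "C \<noteq> {}" for x C
    using legendre_attained_on_closed[of x \<psi> C] that cont by (auto simp: D_def dom_def)
  define T where "T x = (if x \<in> D then THE y. legendre \<psi> x = ereal (x \<bullet> y - \<psi> y) else 0)" for x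
  have T: "legendre \<psi> x = ereal (x \<bullet> y - \<psi> y) \<longleftrightarrow> y = T x" if x: "x \<in> D" for x y
  proof -
    have "\<exists>!y. legendre \<psi> x = ereal (x \<bullet> y - \<psi> y)"
      using attained[OF x, of UNIV] uniq[of x] x by (auto simp: D_def)
    from theI'[OF this] show ?thesis using uniq[of x] x by (auto simp: T_def D_def)
  qed
  \<comment> \<open>This turns membership of \<open>T x\<close> in a closed set into equality of two
    Borel functions of \<open>x\<close>; both measurability and the pushforward property of
    \<open>T\<close> rest on it.\<close>
  have T_in: "T x \<in> C \<longleftrightarrow> legendre_on C \<psi> x = legendre \<psi> x" if x: "x \<in> D" and C: "closed C" for x C
  proof
    assume "T x \<in> C"
    then have "legendre \<psi> x \<le> legendre_on C \<psi> x"
      using T[OF x, of "T x"] legendre_on_upper[of "T x" C x \<psi>] by simp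
    moreover have "legendre_on C \<psi> x \<le> legendre \<psi> x"
      by (intro legendre_on_least legendre_on_upper) auto
    ultimately show "legendre_on C \<psi> x = legendre \<psi> x" by simp
  next
    assume eq: "legendre_on C \<psi> x = legendre \<psi> x"
    then have "C \<noteq> {}" using legendre_not_MInf[of \<psi> x] by (auto simp: legendre_on_def bot_ereal_def)
    from attained[OF x C this] eq T[OF x] show "T x \<in> C" by auto
  qed
  have T_meas [measurable]: "T \<in> borel_measurable borel"
  proof (rule borel_measurableI)
    \<comment> \<open>On \<open>D\<close>, the point \<open>T x\<close> lies in \<open>U\<close>
      exactly when the supremum over the closed complement of \<open>U\<close> falls short. Off
      \<open>D\<close> the default value \<open>0\<close> decides.\<close>
    fix U :: "'a set" assume U: "open U"
    have "closed (- U)" using U by (rule closed_Compl)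
    have "T -` U \<inter> space borel =
        D \<inter> {x \<in> space borel. legendre_on (- U) \<psi> x \<noteq> legendre \<psi> x} \<union> (if 0 \<in> U then - D else {})"
      (is "_ = ?R")
    proof (rule set_eqI)
      fix x show "x \<in> T -` U \<inter> space borel \<longleftrightarrow> x \<in> ?R"
      proof (cases "x \<in> D")
        case True
        with T_in[OF this \<open>closed (- U)\<close>] show ?thesis by auto
      next
        case False
        then show ?thesis by (simp add: T_def)
      qed
    qed
    moreover have "{x \<in> space borel. legendre_on (- U) \<psi> x \<noteq> legendre \<psi> x} \<in> sets borel" by measurable
    then have "?R \<in> sets borel" using D_sets by auto
    ultimately show "T -` U \<inter> space borel \<in> sets borel" by simp
  qed
  have "N = distr M borel T"
  proof (rule prob_measures_eqI_closed)
    show "prob_space (distr M borel T)" by (rule M.prob_space_distr) measurable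
    fix C :: "'a set" assume C: "closed C"
    show "measure N C \<le> measure (distr M borel T) C"
    proof (cases "C = {}")
      case False
      \<comment> \<open>The loss caused by restricting the supremum to \<open>C\<close>; on
        \<open>D\<close> it vanishes exactly when \<open>T x\<close> lies in
        \<open>C\<close>.\<close>
      define h where "h x = real_of_ereal (legendre \<psi> x - legendre_on C \<psi> x)" for x
      have [measurable]: "h \<in> borel_measurable borel" unfolding h_def by measurable
      have hC: "legendre_on C \<psi> x = ereal (p x - h x)" "0 \<le> h x" if x: "x \<in> D" for x
      proof -
        obtain y where y: "legendre_on C \<psi> x = ereal (x \<bullet> y - \<psi> y)"
          using attained[OF x C False] by blast
        have 1: "legendre \<psi> x = ereal (p x)" unfolding p_def by (rule legendre_eq_real[OF D_fin[OF x]])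
        have 2: "h x = p x - (x \<bullet> y - \<psi> y)" unfolding h_def y 1 by simp
        show "legendre_on C \<psi> x = ereal (p x - h x)" unfolding y 2 by simp
        show "0 \<le> h x" unfolding 2 p_def using fenchel_young[OF D_fin[OF x], of y] by simp
      qed
      \<comment> \<open>With \<open>e = 1 / (n + 1)\<close>, the product \<open>e * u n x\<close> is
        \<open>max 0 (e - h x)\<close>, on \<open>D\<close> the exact growth of the transform when
        \<open>\<psi>\<close> is lowered by \<open>e\<close> on \<open>C\<close>.\<close>
      define u where "u n x = max 0 (1 - real (Suc n) * h x)" for n x
      have [measurable]: "u n \<in> borel_measurable borel" for n unfolding u_def by measurable
      have u_bd: "AE x in M. norm (u n x) \<le> 1" for n
        using AE_D by eventually_elim (use hC(2) in \<open>auto simp: u_def\<close>)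
      have u_int: "integrable M (u n)" for n
        by (rule M.integrable_const_bound[OF u_bd]) measurable
      have le_u: "measure N C \<le> (\<integral>x. u n x \<partial>M)" for n
      proof -
        define e where "e = 1 / real (Suc n)"
        have e: "e > 0" by (simp add: e_def)
        have eu: "e - h x \<le> e * u n x" "0 \<le> e * u n x" for x
        proof -
          have "e * (1 - real (Suc n) * h x) \<le> e * u n x"
            using e by (intro mult_left_mono) (auto simp: u_def)
          moreover have "e * (1 - real (Suc n) * h x) = e - h x"
            by (simp add: e_def field_simps)
          ultimately show "e - h x \<le> e * u n x" by simp
          show "0 \<le> e * u n x" using e by (auto simp: u_def)
        qed
        have intC: "integrable N (indicator C :: 'a \<Rightarrow> real)"
          using C by (intro integrable_real_indicator) (auto simp: sets_N N.emeasure_eq_measure)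
        have ineq: "x \<bullet> y \<le> (p x + e * u n x) + (\<psi> y - e * indicator C y)" if x: "x \<in> D" for x y
        proof (cases "y \<in> C")
          case True
          then have "x \<bullet> y - \<psi> y \<le> p x - h x"
            using legendre_on_upper[OF True, of x \<psi>] hC(1)[OF x] by simp
          then show ?thesis using True eu(1)[of x] by simp
        next
          case False
          then show ?thesis using fenchel_young[OF D_fin[OF x], of y] eu(2)[of x] by (simp add: p_def)
        qed
        \<comment> \<open>Minimality against the perturbed pair: the gain
          \<open>e * measure N C\<close> cannot exceed the growth of the transform, and division by
          \<open>e\<close> gives the claim.\<close>
        have "(\<integral>x. p x \<partial>M) + (\<integral>y. \<psi> y \<partial>N)
            \<le> (\<integral>x. p x + e * u n x \<partial>M) + (\<integral>y. \<psi> y - e * indicator C y \<partial>N)"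
          using min[rule_format, OF AE_D _ _ ineq, folded p_def] int[folded p_def] u_int potential_integrable[OF \<psi>] intC
          by simp
        also have "\<dots> = (\<integral>x. p x \<partial>M) + e * (\<integral>x. u n x \<partial>M) + ((\<integral>y. \<psi> y \<partial>N) - e * measure N C)"
          using int[folded p_def] u_int potential_integrable[OF \<psi>] intC C by (simp add: sets_N)
        finally have "e * measure N C \<le> e * (\<integral>x. u n x \<partial>M)" by simp
        then show ?thesis using e by simp
      qed
      \<comment> \<open>If \<open>h x = 0\<close> then \<open>u n x = 1\<close> for all
        \<open>n\<close>; if \<open>h x > 0\<close> then it vanishes for large
        \<open>n\<close>.\<close>
      have lim: "(\<lambda>n. u n x) \<longlonglongrightarrow> indicator (T -` C) x" if x: "x \<in> D" for x
      proof (cases "h x = 0")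
        case True
        then have "T x \<in> C"
          using T_in[OF x C] hC(1)[OF x] legendre_eq_real[OF D_fin[OF x]] by (simp add: p_def)
        with True show ?thesis by (simp add: u_def)
      next
        case False
        then have "T x \<notin> C"
          using T_in[OF x C] hC(1)[OF x] legendre_eq_real[OF D_fin[OF x]]
          by (metis add.right_neutral diff_add_cancel ereal.inject p_def add_left_cancel)
        have "h x > 0" using False hC(2)[OF x] by simp
        then obtain m where m: "1 < real m * h x" using reals_Archimedean3 by blast
        have "eventually (\<lambda>n. u n x = 0) sequentially"
        proof (rule eventually_sequentiallyI[of m])
          fix n assume "m \<le> n"
          then have "real m * h x \<le> real (Suc n) * h x" using \<open>h x > 0\<close> by (intro mult_right_mono) auto
          with m show "u n x = 0" by (simp add: u_def)
        qed
        then have "(\<lambda>n. u n x) \<longlonglongrightarrow> 0" by (rule tendsto_eventually)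
        with \<open>T x \<notin> C\<close> show ?thesis by simp
      qed
      have "(\<lambda>n. \<integral>x. u n x \<partial>M) \<longlonglongrightarrow> (\<integral>x. indicator (T -` C) x \<partial>M)"
      proof (rule integral_dominated_convergence[where w = "\<lambda>_. 1"])
        show "AE x in M. (\<lambda>n. u n x) \<longlonglongrightarrow> indicator (T -` C) x"
          using AE_D by eventually_elim (rule lim)
        show "indicator (T -` C) \<in> borel_measurable M"
          using C measurable_sets[OF T_meas, of C] by (intro borel_measurable_indicator) (simp add: sets_M)
      qed (use u_bd in auto)
      then have "measure N C \<le> (\<integral>x. indicator (T -` C) x \<partial>M)"
        by (rule LIMSEQ_le_const) (use le_u in auto)
      also have "\<dots> = measure M (T -` C)" by simp
      also have "\<dots> = measure (distr M borel T) C"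
        using C by (subst measure_distr) auto
      finally show ?thesis .
    qed simp
  qed (use N.prob_space_axioms sets_N in auto)
  moreover have "AE x in M. \<forall>y. x \<bullet> y \<le> p x + \<psi> y \<and> (x \<bullet> y = p x + \<psi> y \<longleftrightarrow> y = T x)"
    using AE_D
  proof eventually_elim
    fix x assume x: "x \<in> D"
    have "legendre \<psi> x = ereal (p x)" unfolding p_def by (rule legendre_eq_real[OF D_fin[OF x]])
    then have "p x = x \<bullet> y - \<psi> y \<longleftrightarrow> y = T x" for y using T[OF x, of y] by simp
    moreover have "x \<bullet> y - \<psi> y \<le> p x" for y
      unfolding p_def by (rule fenchel_young[OF D_fin[OF x]])
    ultimately show "\<forall>y. x \<bullet> y \<le> p x + \<psi> y \<and> (x \<bullet> y = p x + \<psi> y \<longleftrightarrow> y = T x)"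
      by (metis add.commute diff_le_eq diff_eq_eq)
  qed
  ultimately show ?thesis
    using int potential_integrable[OF \<psi>] by (intro that[of T p \<psi>]) (auto simp: p_def[abs_def])
qed

end

section \<open>The Monge problem\<close>

text \<open>Sets of the trace on a Borel set \<open>A\<close> are themselves Borel, so extending a
  measure by zero to the whole space loses nothing.\<close>

lemma distr_borel_restrict_inject:
  assumes "sets P = sets (restrict_space borel A)" "sets Q = sets (restrict_space borel A)"
    and "A \<in> sets borel" and eq: "distr P borel (\<lambda>x. x) = distr Q borel (\<lambda>x. x)"
  shows "P = Q"
proof (rule measure_eqI)
  have em: "emeasure (distr Z borel (\<lambda>x. x)) B = emeasure Z B"
    if Z: "sets Z = sets (restrict_space borel A)" and B: "B \<in> sets Z" for Z B
  proof -
    have "(\<lambda>x. x) \<in> Z \<rightarrow>\<^sub>M borel"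
      by (subst measurable_cong_sets[OF Z refl]) (rule measurable_restrict_space1, simp)
    moreover have "B \<in> sets borel" using B assms(3) by (auto simp: Z sets_restrict_space_iff)
    moreover have "B \<subseteq> space Z" using B by (rule sets.sets_into_space)
    ultimately show ?thesis by (subst emeasure_distr) (auto simp: Int_absorb2)
  qed
  fix B assume "B \<in> sets P"
  then show "emeasure P B = emeasure Q B" using em[of P B] em[of Q B] assms eq by simp
qed (use assms in simp)

text \<open>\<open>P\<close> and \<open>Q\<close> live on subsets, so they are first pushed along
  the inclusions to whole-space measures \<open>M\<close> and \<open>N\<close>. The map found there
  is afterwards corrected to take values in \<open>X\<close>.\<close>

lemma monge_problem_unique_solution:
  fixes W X :: "'a::euclidean_space set" and P Q :: "'a measure"
  assumes P: "prob_space P" and sets_P: "sets P = sets (restrict_space borel W)"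
    and W: "W \<in> sets borel" "bounded W"
    and ac: "\<And>A. A \<in> null_sets lborel \<Longrightarrow> emeasure P (A \<inter> W) = 0"
    and Q: "prob_space Q" and sets_Q: "sets Q = sets (restrict_space borel X)"
    and X: "X \<in> sets borel"
    and moment: "integrable Q (\<lambda>x. (norm x)\<^sup>2)"
  shows "\<exists>\<phi>. monge_optimal P Q cost_I \<phi> \<and>
    (\<forall>\<psi>. monge_optimal P Q cost_I \<psi> \<longrightarrow> (AE u in P. \<psi> u = \<phi> u))"
proof -
  interpret P: prob_space P by fact
  interpret Q: prob_space Q by fact
  have space_P: "space P = W" and space_Q: "space Q = X"
    using sets_eq_imp_space_eq[OF sets_P] sets_eq_imp_space_eq[OF sets_Q] by (simp_all add: space_restrict_space)
  have to_P: "h \<in> P \<rightarrow>\<^sub>M Z" if "h \<in> borel \<rightarrow>\<^sub>M Z" for h :: "'a \<Rightarrow> 'b" and Z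
    using measurable_restrict_space1[OF that] unfolding measurable_cong_sets[OF sets_P refl] .
  have to_Q: "h \<in> Q \<rightarrow>\<^sub>M Z" if "h \<in> borel \<rightarrow>\<^sub>M Z" for h :: "'a \<Rightarrow> 'b" and Z
    using measurable_restrict_space1[OF that] unfolding measurable_cong_sets[OF sets_Q refl] .
  have idP: "(\<lambda>x. x) \<in> P \<rightarrow>\<^sub>M borel" and idQ: "(\<lambda>x. x) \<in> Q \<rightarrow>\<^sub>M borel"
    by (intro to_P to_Q measurable_ident_sets refl)+
  define M where "M = distr P borel (\<lambda>x. x)"
  define N where "N = distr Q borel (\<lambda>x. x)"
  obtain R where R: "R > 0" "\<And>x. x \<in> W \<Longrightarrow> norm x \<le> R" using W(2) bounded_pos by blast
  have sq: "integrable N (\<lambda>y. (norm y)\<^sup>2)"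
    unfolding N_def by (subst integrable_distr_eq[OF idQ]) (auto intro: moment)
  interpret M: prob_space M unfolding M_def by (rule P.prob_space_distr[OF idP])
  interpret N: prob_space N unfolding N_def by (rule Q.prob_space_distr[OF idQ])
  interpret dual_transport M N R
  proof
    show "AE x in M. norm x \<le> R"
      unfolding M_def by (subst AE_distr_iff[OF idP]) (auto intro!: AE_I2 R simp: space_P)
    show "integrable N norm"
    proof (rule Bochner_Integration.integrable_bound)
      show "integrable N (\<lambda>y. 1 + (norm y)\<^sup>2)" using sq by simp
      \<comment> \<open>From \<open>2 * norm y \<le> 1 + (norm y)\<^sup>2\<close>: the finite second
        moment controls the first.\<close>
      have "norm y \<le> 1 + (norm y)\<^sup>2" for y :: 'a
        using sum_squares_bound[of 1 "norm y"] norm_ge_zero[of y] unfolding one_power2 by linarith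
      then have "norm (norm y) \<le> norm (1 + (norm y)\<^sup>2)" for y :: 'a
        by (metis abs_ge_self abs_norm_cancel order_trans real_norm_def)
      then show "AE y in N. norm (norm y) \<le> norm (1 + (norm y)\<^sup>2)" by simp
    qed (simp add: N_def)
  qed (use R in \<open>auto simp: M_def N_def\<close>)
  have "absolutely_continuous lborel M"
    unfolding absolutely_continuous_def
  proof
    fix A :: "'a set" assume A: "A \<in> null_sets lborel"
    then have "emeasure M A = emeasure P (A \<inter> W)"
      unfolding M_def by (subst emeasure_distr[OF idP]) (auto simp: space_P null_setsD2)
    with ac[OF A] A show "A \<in> null_sets M" by (auto intro!: null_setsI simp: sets_M)
  qed
  then obtain T f g where [measurable]: "T \<in> borel_measurable borel" and TN: "distr M borel T = N"
    and f: "integrable M f" and g: "integrable N g"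
    and fg: "AE x in M. \<forall>y. x \<bullet> y \<le> f x + g y \<and> (x \<bullet> y = f x + g y \<longleftrightarrow> y = T x)"
    by (rule brenier)
  have AE_P: "AE u in P. p u" if "AE u in M. p u" for p
    using that unfolding M_def by (rule AE_distrD[OF idP])
  note fgP = AE_P[OF fg]
  have fP: "integrable P f" and int_f: "(\<integral>u. f u \<partial>P) = (\<integral>u. f u \<partial>M)"
  proof -
    have [measurable]: "f \<in> borel_measurable borel" using f sets_M by (auto dest!: borel_measurable_integrable)
    show "integrable P f" using f unfolding M_def by (subst (asm) integrable_distr_eq[OF idP]) auto
    show "(\<integral>u. f u \<partial>P) = (\<integral>u. f u \<partial>M)" unfolding M_def by (subst integral_distr[OF idP]) auto
  qed
  have [measurable]: "g \<in> borel_measurable borel" using g sets_N by (auto dest!: borel_measurable_integrable)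
  \<comment> \<open>The dual value \<open>J\<close> bounds the correlation of every transport map.
    The constant \<open>c\<close> sums the two second moments and is the same for all these maps, as
    they share the image law.\<close>
  define J where "J = (\<integral>u. f u \<partial>P) + (\<integral>y. g y \<partial>N)"
  define c where "c = (\<integral>u. (norm u)\<^sup>2 \<partial>P) + (\<integral>y. (norm y)\<^sup>2 \<partial>N)"
  have sqP: "integrable P (\<lambda>u. (norm u)\<^sup>2)"
  proof (rule P.integrable_const_bound)
    show "AE u in P. norm ((norm u)\<^sup>2) \<le> R\<^sup>2"
      using R by (auto intro!: AE_I2 power_mono simp: space_P)
  qed (auto intro!: to_P)
  have main: "integrable P (\<lambda>u. u \<bullet> S u)" "integrable P (\<lambda>u. g (S u))"
    "(\<integral>u. g (S u) \<partial>P) = (\<integral>y. g y \<partial>N)"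
    "transport_cost cost_I P S = ennreal (c - 2 * (\<integral>u. u \<bullet> S u \<partial>P))"
    "0 \<le> c - 2 * (\<integral>u. u \<bullet> S u \<partial>P)"
    if S: "S \<in> transport_maps P Q" for S
  proof -
    have SQ: "S \<in> P \<rightarrow>\<^sub>M Q" and SD: "distr P Q S = Q" using S by (auto simp: transport_maps_def)
    have Sb: "S \<in> borel_measurable P" using measurable_compose[OF SQ idQ] .
    have "distr (distr P Q S) borel (\<lambda>x. x) = distr P borel S"
      by (subst distr_distr[OF idQ SQ]) (simp add: o_def)
    then have SN: "distr P borel S = N" by (simp add: SD N_def)
    have intS: "integrable P (\<lambda>u. h (S u))" "(\<integral>u. h (S u) \<partial>P) = (\<integral>y. h y \<partial>N)"
      if "integrable N h" for h :: "'a \<Rightarrow> real"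
    proof -
      have h: "h \<in> borel_measurable borel" using that sets_N by (auto dest!: borel_measurable_integrable)
      show "integrable P (\<lambda>u. h (S u))"
        using that unfolding SN[symmetric] by (subst (asm) integrable_distr_eq[OF Sb h])
      show "(\<integral>u. h (S u) \<partial>P) = (\<integral>y. h y \<partial>N)"
        unfolding SN[symmetric] by (subst integral_distr[OF Sb h]) simp
    qed
    show "integrable P (\<lambda>u. g (S u))" "(\<integral>u. g (S u) \<partial>P) = (\<integral>y. g y \<partial>N)"
      by (fact intS[OF g])+
    show inner: "integrable P (\<lambda>u. u \<bullet> S u)"
    proof (rule Bochner_Integration.integrable_bound)
      show "integrable P (\<lambda>u. R * norm (S u))" using intS(1)[OF first_moment_N] by simp
      show "(\<lambda>u. u \<bullet> S u) \<in> borel_measurable P" using idP Sb by measurable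
      show "AE u in P. norm (u \<bullet> S u) \<le> norm (R * norm (S u))"
      proof (rule AE_I2)
        fix u assume "u \<in> space P"
        then have "norm u * norm (S u) \<le> R * norm (S u)" using R by (intro mult_right_mono) (auto simp: space_P)
        with Cauchy_Schwarz_ineq2[of u "S u"] R(1) show "norm (u \<bullet> S u) \<le> norm (R * norm (S u))"
          by (simp add: abs_mult)
      qed
    qed
    have cost: "cost_I u v = (norm u)\<^sup>2 + (norm v)\<^sup>2 - 2 * (u \<bullet> v)" for u v :: 'a
      by (simp add: cost_I_def power2_norm_eq_inner inner_diff_left inner_diff_right inner_commute)
    have int: "integrable P (\<lambda>u. cost_I u (S u))"
      unfolding cost using sqP intS(1)[OF sq] inner by simp
    have val: "(\<integral>u. cost_I u (S u) \<partial>P) = c - 2 * (\<integral>u. u \<bullet> S u \<partial>P)"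
      unfolding cost c_def using sqP intS[OF sq] inner by simp
    show "transport_cost cost_I P S = ennreal (c - 2 * (\<integral>u. u \<bullet> S u \<partial>P))"
      unfolding transport_cost_def val[symmetric]
      using int by (intro nn_integral_eq_integral) (auto simp: cost_I_def)
    show "0 \<le> c - 2 * (\<integral>u. u \<bullet> S u \<partial>P)"
      unfolding val[symmetric] by (rule Bochner_Integration.integral_nonneg) (simp add: cost_I_def)
  qed
  have le_J: "(\<integral>u. u \<bullet> S u \<partial>P) \<le> J"
    and eq_J: "(\<integral>u. u \<bullet> S u \<partial>P) = J \<longleftrightarrow> (AE u in P. S u = T u)"
    if S: "S \<in> transport_maps P Q" for S
  proof -
    \<comment> \<open>The integrand is nonnegative almost everywhere and vanishes only where
      \<open>S u = T u\<close>; a zero integral therefore forces almost everywhere equality.\<close>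
    have gap: "(\<integral>u. f u + g (S u) - u \<bullet> S u \<partial>P) = J - (\<integral>u. u \<bullet> S u \<partial>P)"
      using main(1-3)[OF S] fP by (simp add: J_def)
    have int: "integrable P (\<lambda>u. f u + g (S u) - u \<bullet> S u)" using main(1,2)[OF S] fP by simp
    have nn: "AE u in P. 0 \<le> f u + g (S u) - u \<bullet> S u"
      using fgP by eventually_elim simp
    show "(\<integral>u. u \<bullet> S u \<partial>P) \<le> J" using integral_nonneg_AE[OF nn] gap by simp
    have "(\<integral>u. u \<bullet> S u \<partial>P) = J \<longleftrightarrow> (AE u in P. f u + g (S u) - u \<bullet> S u = 0)"
      using integral_nonneg_eq_0_iff_AE[OF int nn] gap by auto
    also have "\<dots> \<longleftrightarrow> (AE u in P. S u = T u)"
    proof (rule eventually_cong)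
      show "AE u in P. (f u + g (S u) - u \<bullet> S u = 0) = (S u = T u)"
        using fgP by eventually_elim (metis eq_iff_diff_eq_0)
    qed
    finally show "(\<integral>u. u \<bullet> S u \<partial>P) = J \<longleftrightarrow> (AE u in P. S u = T u)" .
  qed
  obtain x0 where x0: "x0 \<in> X" using Q.not_empty space_Q by auto
  \<comment> \<open>\<open>T\<close> takes values in \<open>X\<close> only almost everywhere.
    Sending the exceptional points to some \<open>x0\<close> gives a map into the space of
    \<open>Q\<close> without changing the pushforward.\<close>
  define \<phi> where "\<phi> u = (if T u \<in> X then T u else x0)" for u
  have \<phi>_meas: "\<phi> \<in> borel_measurable borel" unfolding \<phi>_def using X by measurable
  have "AE y in N. y \<in> X"
    unfolding N_def by (subst AE_distr_iff[OF idQ]) (auto intro!: AE_I2 simp: space_Q X)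
  then have "AE u in M. T u \<in> X"
    unfolding TN[symmetric] by (subst (asm) AE_distr_iff) (auto simp: X sets_M)
  then have \<phi>_T: "AE u in P. \<phi> u = T u"
    using AE_P by (force simp: \<phi>_def)
  have \<phi>_PQ: "\<phi> \<in> P \<rightarrow>\<^sub>M Q"
  proof (subst measurable_cong_sets[OF refl sets_Q], rule measurable_restrict_space2)
    show "\<phi> \<in> space P \<rightarrow> X" using x0 by (auto simp: \<phi>_def)
  qed (rule to_P[OF \<phi>_meas])
  have "distr (distr P Q \<phi>) borel (\<lambda>x. x) = distr P borel \<phi>"
    by (subst distr_distr[OF idQ \<phi>_PQ]) (simp add: o_def)
  also have "\<dots> = distr P borel T"
    using \<phi>_T by (intro distr_cong_AE) (auto intro!: to_P \<phi>_meas)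
  also have "\<dots> = distr M borel T"
    unfolding M_def by (subst distr_distr[OF _ idP]) (simp_all add: o_def)
  finally have "distr (distr P Q \<phi>) borel (\<lambda>x. x) = distr Q borel (\<lambda>x. x)"
    unfolding TN N_def .
  then have "distr P Q \<phi> = Q"
    by (intro distr_borel_restrict_inject[OF _ sets_Q X]) (simp add: sets_Q)
  with \<phi>_PQ have \<phi>: "\<phi> \<in> transport_maps P Q" by (simp add: transport_maps_def)
  have \<phi>_J: "(\<integral>u. u \<bullet> \<phi> u \<partial>P) = J" using eq_J[OF \<phi>] \<phi>_T by simp
  have min: "transport_cost cost_I P \<phi> \<le> transport_cost cost_I P S" if S: "S \<in> transport_maps P Q" for S
    unfolding main(4)[OF \<phi>] main(4)[OF S] using le_J[OF S] \<phi>_J by (intro ennreal_leI) simp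
  have "monge_optimal P Q cost_I \<phi>"
    unfolding monge_optimal_def using \<phi> min by (auto intro!: antisym INF_greatest INF_lower)
  moreover have "AE u in P. \<psi> u = \<phi> u" if opt: "monge_optimal P Q cost_I \<psi>" for \<psi>
  proof -
    have \<psi>: "\<psi> \<in> transport_maps P Q" using opt by (simp add: monge_optimal_def)
    have "transport_cost cost_I P \<psi> \<le> transport_cost cost_I P \<phi>"
      using opt \<phi> by (auto simp: monge_optimal_def intro: INF_lower)
    \<comment> \<open>The cost of \<open>\<phi>\<close> is a nonnegative real, so comparing the
      \<open>ennreal\<close> costs compares the underlying real numbers.\<close>
    then have "c - 2 * (\<integral>u. u \<bullet> \<psi> u \<partial>P) \<le> c - 2 * J"
      using main(4,5)[OF \<phi>] main(4)[OF \<psi>] by (simp add: \<phi>_J ennreal_le_iff)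
    with le_J[OF \<psi>] have "(\<integral>u. u \<bullet> \<psi> u \<partial>P) = J" by simp
    then have "AE u in P. \<psi> u = T u" by (simp add: eq_J[OF \<psi>])
    with \<phi>_T show ?thesis by eventually_elim simp
  qed
  ultimately show ?thesis by blast
qed

section \<open>The uniform distribution and the capacity-achieving target\<close>

text \<open>A nonempty open set has positive Lebesgue measure and a bounded set has finite measure,
  so normalization yields a probability measure. Null sets are intersected with \<open>W\<close>
  because the measure lives on subsets of \<open>W\<close>.\<close>

lemma uniform_on_facts:
  fixes W :: "'a::euclidean_space set"
  assumes W: "open W" "bounded W" "W \<noteq> {}"
  shows prob_space_uniform_on: "prob_space (uniform_on W)"
    and sets_uniform_on: "sets (uniform_on W) = sets (restrict_space borel W)"
    and uniform_on_null: "A \<in> null_sets lborel \<Longrightarrow> emeasure (uniform_on W) (A \<inter> W) = 0"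
proof -
  have Wb: "W \<in> sets borel" using W by simp
  show "sets (uniform_on W) = sets (restrict_space borel W)"
    unfolding uniform_on_def by (simp add: sets_restrict_space)
  have em: "emeasure (restrict_space lborel W) B = emeasure lborel B" if "B \<subseteq> W" for B
    using that Wb by (intro emeasure_restrict_space) auto
  show "prob_space (uniform_on W)"
    unfolding uniform_on_def
  proof (rule prob_space_uniform_measure)
    have "W \<notin> null_sets lborel"
      using open_not_negligible[OF W(1,3)] by (auto simp: negligible_iff_null_sets null_sets_completionI)
    then show "emeasure (restrict_space lborel W) W \<noteq> 0"
      using Wb by (auto simp: em intro: null_setsI)
    show "emeasure (restrict_space lborel W) W \<noteq> \<infinity>"
      using emeasure_bounded_finite[OF W(2)] by (simp add: em)
  qed
  show "emeasure (uniform_on W) (A \<inter> W) = 0" if A: "A \<in> null_sets lborel"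
  proof -
    have "emeasure lborel (A \<inter> W) = 0"
      using A Wb null_set_Int2[of A lborel W] by (auto simp: Int_commute)
    moreover have "A \<inter> W \<in> sets (restrict_space lborel W)"
      using A Wb by (auto simp: sets_restrict_space_iff)
    moreover have "W \<in> sets (restrict_space lborel W)"
      using Wb by (auto simp: sets_restrict_space_iff)
    ultimately show ?thesis
      unfolding uniform_on_def by (simp add: em Int_absorb1)
  qed
qed

theorem corollary4p21:
  fixes W X :: "(real ^ 'd) set"
    and K :: "real ^ 'd \<Rightarrow> 'y::euclidean_space measure"
    and \<eta> :: "real ^ 'd \<Rightarrow> real"
    and L :: real
    and PX :: "(real ^ 'd) measure"
  assumes "open W" and "bounded W" and "convex W" and "W \<noteq> {}"
    and "X \<in> sets borel"
    and "K \<in> restrict_space borel X \<rightarrow>\<^sub>M prob_algebra borel"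
    and "\<eta> \<in> borel_measurable (restrict_space borel X)"
    and "\<And>x. x \<in> X \<Longrightarrow> 0 \<le> \<eta> x"
    and "capacity_achieving (restrict_space borel X) K \<eta> L PX"
    and "channel_information PX K < \<infinity>"
    and "integrable PX (\<lambda>x. (norm x)\<^sup>2)"
  shows "\<exists>\<phi>. monge_optimal (uniform_on W) PX cost_I \<phi> \<and>
           distr (uniform_on W) PX \<phi> = PX \<and>
           (\<forall>\<psi>. monge_optimal (uniform_on W) PX cost_I \<psi> \<longrightarrow> (AE u in uniform_on W. \<psi> u = \<phi> u))"
proof -
  \<comment> \<open>A maximizer is admissible, hence a probability measure on the Borel sets of
    \<open>X\<close>, as the transport result requires.\<close>
  have "PX \<in> space (prob_algebra (restrict_space borel X))"
    using assms(9) by (simp add: capacity_achieving_def is_arg_max_def admissible_inputs_def)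
  then have PX: "prob_space PX" "sets PX = sets (restrict_space borel X)"
    by (simp_all add: space_prob_algebra)
  have "\<exists>\<phi>. monge_optimal (uniform_on W) PX cost_I \<phi> \<and>
    (\<forall>\<psi>. monge_optimal (uniform_on W) PX cost_I \<psi> \<longrightarrow> (AE u in uniform_on W. \<psi> u = \<phi> u))"
    using assms(1,2,4,5,11) PX
    by (intro monge_problem_unique_solution[where W = W and X = X]
        prob_space_uniform_on sets_uniform_on uniform_on_null) auto
  then show ?thesis by (auto simp: monge_optimal_def transport_maps_def)
qed

end
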